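(* Let $\rho$ be the standard Gaussian density on $\mathbb{R}^m$, and let $f:\mathbb{R}^m\to\mathbb{R}$ be continuous and differentiable with continuous partial derivatives, with $f$ and each $\partial f/\partial x_i$ square-integrable with respect to $\rho$. Assume (i) $f$ is Lipschitz continuous with constant $L$, and (ii) $\lambda_n>\lambda_{n+1}$ for some $n<m$, where $\lambda_1\ge\cdots\ge\lambda_m\ge0$ are the eigenvalues of $C=\int\nabla f(x)\nabla f(x)^T\rho(x)\,dx=W\Lambda W^T$. Write $W=[W_1\ W_2]$ with $W_1\in\mathbb{R}^{m\times n}$ containing eigenvectors for $\lambda_1,\dots,\lambda_n$ and $W_2\in\mathbb{R}^{m\times(m-n)}$ containing eigenvectors for $\lambda_{n+1},\dots,\lambda_m$. Then $$\|\bar\nabla R(W_2)\|_F\;\le\; L\left(2m^{1/2}+(m-n)^{1/2}\right)\left(\lambda_{n+1}+\cdots+\lambda_m\right)^{1/2}.$$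
   Context: For $V\in\mathbb{R}^{m\times(m-n)}$ with orthonormal columns, define $$\mu(x,V)=\int_{\mathbb{R}^{m-n}} f\big((I-VV^T)x+Vz\big)\,\pi(z)\,dz,$$ where $\pi$ is the standard Gaussian density on $\mathbb{R}^{m-n}$ (this is the conditional density of the complement coordinates $z$ given the coordinates $y=U^Tx$ on the orthogonal complement $U$ of $\mathrm{span}(V)$, when $\rho$ is standard Gaussian; $\mu(\cdot,V)$ is the conditional average of $f$ over the affine subspace $\{(I-VV^T)x+Vz: z\in\mathbb{R}^{m-n}\}$). Define $R(V)=\tfrac12\int (f(x)-\mu(x,V))^2\rho(x)\,dx$, which depends only on $\mathrm{span}(V)$ and is thus a function on the Grassmann manifold $\mathbb{G}(m-n,m)$ of $(m-n)$-dimensional subspaces of $\mathbb{R}^m$. The Grassmann gradient is $\bar\nabla R(V)=(I-VV^T)\,\frac{\partial R}{\partial V}(V)$, where $\frac{\partial R}{\partial V}$ is the $m\times(m-n)$ matrix of partial derivatives of $R$ with respect to the entries $v_{ij}$ of $V$. $\|\cdot\|_F$ is the Frobenius norm. The span of $W_1$ is called the active subspace. *)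

theory Defs
  imports "HOL-Analysis.Analysis"
begin

definition gauss_dens :: "'a::euclidean_space \<Rightarrow> real" where
  "gauss_dens x = (2 * pi) powr (- real DIM('a) / 2) * exp (- (norm x)\<^sup>2 / 2)"

definition grad_cov :: "(real^'m \<Rightarrow> real^'m) \<Rightarrow> real^'m^'m" where
  "grad_cov Df = (\<chi> i j. LINT x|lborel. Df x $ i * Df x $ j * gauss_dens x)"

definition cond_avg :: "(real^'m \<Rightarrow> real) \<Rightarrow> real^'m \<Rightarrow> real^'k^'m \<Rightarrow> real" where
  "cond_avg f x V = (LINT z|lborel.
      f ((mat 1 - V ** transpose V) *v x + V *v z) * gauss_dens (z :: real^'k))"

definition resid :: "(real^'m \<Rightarrow> real) \<Rightarrow> real^'k^'m \<Rightarrow> real" where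
  "resid f V = 1/2 * (LINT x|lborel. (f x - cond_avg f x V)\<^sup>2 * gauss_dens x)"

definition elem_mat :: "'m \<Rightarrow> 'k \<Rightarrow> real^'k^'m" where
  "elem_mat i j = (\<chi> a b. if a = i \<and> b = j then 1 else 0)"

definition frob_norm :: "real^'k^'m \<Rightarrow> real" where
  "frob_norm A = sqrt (\<Sum>i\<in>UNIV. \<Sum>j\<in>UNIV. (A $ i $ j)\<^sup>2)"

end

theory Submission
  imports Defs "HOL-Probability.Probability"
begin

text \<open>Write \<open>V\<close> for \<open>W2\<close>, \<open>P = I - V V\<^sup>T\<close> and \<open>mix x z = P x + V z\<close>. For independent standard Gaussian \<open>x\<close>
  and \<open>z\<close> the map \<open>(x, z) \<mapsto> (mix x z, V\<^sup>T x)\<close> preserves the law of the pair, so the residual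
  \<open>f - \<mu>\<close> is orthogonal to every function of \<open>P x\<close>. Differentiating under the integral, the entry
  \<open>(a, j)\<close> of \<open>P G\<close>, with \<open>G\<close> the matrix of partial derivatives, reduces to the integral of
  \<open>(f - \<mu>) (V\<^sup>T x)\<^sub>j (P g)\<^sub>a\<close>, where \<open>g\<close> is the average of \<open>Df\<close> over the fibre. By Stein's identity this is
  the integral of \<open>(P g)\<^sub>a (V\<^sup>T g)\<^sub>j\<close>, and the inequalities of Cauchy-Schwarz and Jensen bound the
  Frobenius norm by \<open>L sqrt (\<Sum>j. l2 j)\<close>, which is better than the claim by the factor
  \<open>2 sqrt m + sqrt k \<ge> 1\<close>.\<close>

text \<open>The partial derivatives run over all matrix entries, so the perturbed frame
  \<open>V + t E\<close> is in general no longer orthonormal. For \<open>t \<noteq> 0\<close> the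
  function \<open>cond_avg\<close> is then a mere integral formula and not a conditional
  expectation, and the orthogonality of the residual is available only after differentiating, at
  \<open>t = 0\<close>. The derivative along the entry \<open>(i, j)\<close> has three parts, coming
  from \<open>z $ j\<close>, from \<open>(V\<^sup>T x) $ j\<close> and from \<open>x $ i\<close>.
  Multiplication by \<open>P\<close> combines the rows \<open>i\<close> and turns the first and the
  third part into functions of \<open>P x\<close>, so they vanish against the residual and need no
  estimate; no dimension factor arises for this reason. The invariance is stated for pairs because
  resampling, \<open>x \<mapsto> mix x z\<close>, forgets the old coordinate: keeping
  \<open>V\<^sup>T x\<close> as second component makes the map invertible and isometric, and it
  hands the old coordinate over to Stein's identity as an independent Gaussian variable. The
  Lipschitz constant bounds \<open>Df\<close> pointwise, which yields the factor \<open>L\<close>,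
  and gives the polynomial growth behind every dominating function.\<close>

section \<open>Differentiation under the integral sign\<close>

text \<open>Dominated convergence applies to the difference quotients along any null sequence, so
  only increments from \<open>0\<close> need a bound, and no control of derivatives at nearby
  parameters enters. Measurability of \<open>H'\<close> comes out as that of a pointwise
  limit.\<close>

lemma has_real_derivative_integral:
  fixes H :: "real \<Rightarrow> 'a \<Rightarrow> real"
  assumes int: "\<And>t. \<bar>t\<bar> < 1 \<Longrightarrow> integrable M (H t)"
    and g: "integrable M g"
    and lip: "\<And>t x. \<bar>t\<bar> < 1 \<Longrightarrow> x \<in> space M \<Longrightarrow> \<bar>H t x - H 0 x\<bar> \<le> g x * \<bar>t\<bar>"
    and der: "\<And>x. x \<in> space M \<Longrightarrow> ((\<lambda>t. H t x) has_real_derivative H' x) (at 0)"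
  shows "integrable M H'"
    and "((\<lambda>t. LINT x|M. H t x) has_real_derivative (LINT x|M. H' x)) (at 0)"
proof -
  have key: "integrable M H' \<and> (\<lambda>n. ((LINT x|M. H (X n) x) - (LINT x|M. H 0 x)) / X n) \<longlonglongrightarrow> (LINT x|M. H' x)"
    if X: "X \<longlonglongrightarrow> 0" and X0: "\<And>n. X n \<noteq> 0" and X1: "\<And>n. \<bar>X n\<bar> < 1" for X :: "nat \<Rightarrow> real"
  proof -
    define s where "s n x = (H (X n) x - H 0 x) / X n" for n x
    have lim: "(\<lambda>n. s n x) \<longlonglongrightarrow> H' x" if "x \<in> space M" for x
    proof -
      have "((\<lambda>h. (H h x - H 0 x) / h) \<longlongrightarrow> H' x) (at 0)"
        using der[OF that] by (simp add: DERIV_def)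
      then show ?thesis
        using X X0 unfolding s_def tendsto_at_iff_sequentially comp_def by auto
    qed
    have int_s: "integrable M (s n)" for n
      unfolding s_def using int[OF X1[of n]] int[of 0] by (intro integrable_divide_zero integrable_diff) auto
    have meas: "H' \<in> borel_measurable M"
      by (rule borel_measurable_LIMSEQ_real[OF lim]) (use int_s in auto)
    have bound: "norm (s n x) \<le> g x" if "x \<in> space M" for n x
      using lip[OF X1[of n] that] X0[of n] by (simp add: s_def abs_divide divide_le_eq)
    have 1: "integrable M H'"
      by (rule integrable_dominated_convergence[of H' M s g]) (use meas int_s g lim bound in auto)
    have 2: "(\<lambda>n. LINT x|M. s n x) \<longlonglongrightarrow> (LINT x|M. H' x)"
      by (rule integral_dominated_convergence[of H' M s g]) (use meas int_s g lim bound in auto)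
    have "(LINT x|M. s n x) = ((LINT x|M. H (X n) x) - (LINT x|M. H 0 x)) / X n" for n
      unfolding s_def using int[OF X1[of n]] int[of 0] by simp
    with 1 2 show ?thesis by simp
  qed
  \<comment> \<open>Integrability of \<open>H'\<close> needs just one admissible sequence; the
    double successor keeps its terms strictly below 1.\<close>
  have "(\<lambda>n. inverse (real (Suc (Suc n)))) \<longlonglongrightarrow> 0"
    using LIMSEQ_inverse_real_of_nat LIMSEQ_Suc by blast
  then show "integrable M H'"
    using key[of "\<lambda>n. inverse (real (Suc (Suc n)))"] by (auto simp: inverse_eq_divide)
  show "((\<lambda>t. LINT x|M. H t x) has_real_derivative (LINT x|M. H' x)) (at 0)"
    unfolding DERIV_def tendsto_at_iff_sequentially
  proof (intro allI impI)
    fix X :: "nat \<Rightarrow> real" assume X: "\<forall>i. X i \<in> UNIV - {0}" "X \<longlonglongrightarrow> 0"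
    have "\<forall>\<^sub>F n in sequentially. \<bar>X n\<bar> < 1"
      using X(2) by (auto simp: tendsto_iff dist_real_def)
    then obtain N where N: "\<And>n. n \<ge> N \<Longrightarrow> \<bar>X n\<bar> < 1"
      by (auto simp: eventually_sequentially)
    have "(\<lambda>n. ((LINT x|M. H (X (n + N)) x) - (LINT x|M. H 0 x)) / X (n + N)) \<longlonglongrightarrow> (LINT x|M. H' x)"
      using key[of "\<lambda>n. X (n + N)"] X N LIMSEQ_ignore_initial_segment[of X 0 N] by auto
    then show "((\<lambda>h. ((LINT x|M. H (0 + h) x) - (LINT x|M. H 0 x)) / h) \<circ> X) \<longlonglongrightarrow> (LINT x|M. H' x)"
      by (simp add: comp_def LIMSEQ_offset)
  qed
qed

section \<open>The standard Gaussian as a probability measure\<close>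

lemma gauss_dens_nonneg [simp]: "0 \<le> gauss_dens x"
  by (simp add: gauss_dens_def)

lemma continuous_on_gauss_dens [continuous_intros]:
  "continuous_on S g \<Longrightarrow> continuous_on S (\<lambda>x. gauss_dens (g x))"
  unfolding gauss_dens_def by (intro continuous_intros) auto

lemma gauss_dens_measurable [measurable]: "gauss_dens \<in> borel_measurable borel"
  by (intro borel_measurable_continuous_onI continuous_intros)

lemma norm_sq_Basis: "(norm (x :: 'a :: euclidean_space))\<^sup>2 = (\<Sum>b\<in>Basis. (x \<bullet> b)\<^sup>2)"
  unfolding power2_norm_eq_inner by (subst euclidean_inner) (simp add: power2_eq_square)

lemma gauss_dens_prod:
  "gauss_dens (x :: 'a :: euclidean_space) = (\<Prod>b\<in>Basis. std_normal_density (x \<bullet> b))"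
proof -
  have "(2 * pi) powr (- real DIM('a) / 2) = (1 / sqrt (2 * pi)) ^ DIM('a)"
    by (simp add: powr_half_sqrt[symmetric] powr_minus_divide power_one_over powr_realpow[symmetric] powr_powr)
  then show ?thesis
    by (simp add: gauss_dens_def std_normal_density_def prod.distrib exp_sum[symmetric]
        norm_sq_Basis sum_divide_distrib sum_negf power_one_over prod_dividef)
qed

lemma gauss_dens_Pair:
  "gauss_dens (x :: 'a :: euclidean_space, y :: 'b :: euclidean_space) = gauss_dens x * gauss_dens y"
proof -
  have "(norm (x, y))\<^sup>2 = (norm x)\<^sup>2 + (norm y)\<^sup>2"
    by (simp add: norm_Pair)
  then have "exp (- (norm (x, y))\<^sup>2 / 2) = exp (- (norm x)\<^sup>2 / 2) * exp (- (norm y)\<^sup>2 / 2)"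
    by (simp add: exp_add[symmetric] add_divide_distrib diff_divide_distrib)
  moreover have "(2 * pi) powr (- real DIM('a \<times> 'b) / 2)
      = (2 * pi) powr (- real DIM('a) / 2) * (2 * pi) powr (- real DIM('b) / 2)"
    by (simp add: powr_add[symmetric] add_divide_distrib diff_divide_distrib)
  ultimately show ?thesis
    by (simp only: gauss_dens_def mult_ac)
qed

text \<open>Absorbing the density into a measure gives access to facts on probability spaces:
  constants integrate to themselves, variances are nonnegative, and products obey Fubini.\<close>

definition gauss_meas :: "'a :: euclidean_space measure" where
  "gauss_meas = density lborel (\<lambda>x. ennreal (gauss_dens x))"

lemma sets_gauss_meas [simp, measurable_cong]: "sets gauss_meas = sets borel"
  by (simp add: gauss_meas_def)

lemma space_gauss_meas [simp]: "space gauss_meas = UNIV"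
  by (simp add: gauss_meas_def)

lemma prob_space_gauss_meas: "prob_space (gauss_meas :: 'a :: euclidean_space measure)"
proof
  have "(\<integral>\<^sup>+t. ennreal (std_normal_density t) \<partial>lborel) = 1"
    by (simp add: nn_integral_eq_integral)
  then have "(\<integral>\<^sup>+x. ennreal (gauss_dens (x :: 'a)) \<partial>lborel) = 1"
    by (simp add: gauss_dens_prod prod_ennreal[symmetric]
        nn_integral_lborel_prod[where f = "\<lambda>_ t. ennreal (std_normal_density t)"])
  then show "emeasure (gauss_meas :: 'a measure) (space gauss_meas) = 1"
    by (simp add: gauss_meas_def emeasure_density)
qed

interpretation gauss: prob_space "gauss_meas :: 'a :: euclidean_space measure"
  by (rule prob_space_gauss_meas)

lemma measure_gauss_meas_UNIV [simp]: "measure gauss_meas UNIV = 1"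
  using gauss.prob_space by simp

lemma integral_gauss_meas:
  fixes g :: "'a :: euclidean_space \<Rightarrow> real"
  assumes "g \<in> borel_measurable borel"
  shows "(LINT x|gauss_meas. g x) = (LINT x|lborel. g x * gauss_dens x)"
  unfolding gauss_meas_def using assms
  by (subst integral_density) (auto simp: mult.commute)

lemma integrable_gauss_meas_iff:
  fixes g :: "'a :: euclidean_space \<Rightarrow> real"
  assumes "g \<in> borel_measurable borel"
  shows "integrable gauss_meas g \<longleftrightarrow> integrable lborel (\<lambda>x. g x * gauss_dens x)"
  unfolding gauss_meas_def using assms
  by (subst integrable_density) (auto simp: mult.commute)

text \<open>Half of the Gaussian exponent absorbs the growth:
  \<open>a * norm x \<le> a\<^sup>2 + (norm x)\<^sup>2 / 4\<close>. What is left,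
  \<open>exp (- (norm x)\<^sup>2 / 4)\<close>, is up to a factor a product of normal densities of
  variance 2.\<close>

lemma integrable_exp_norm:
  "integrable gauss_meas (\<lambda>x :: 'a :: euclidean_space. exp (a * norm x))"
proof -
  have "ennreal (exp (- t\<^sup>2 / 4)) = ennreal (sqrt (4 * pi)) * ennreal (normal_density 0 (sqrt 2) t)" for t
    by (simp add: normal_density_def ennreal_mult'[symmetric])
  then have "(\<integral>\<^sup>+t. ennreal (exp (- t\<^sup>2 / 4)) \<partial>lborel) = ennreal (sqrt (4 * pi))"
    by (simp add: nn_integral_cmult nn_integral_eq_integral)
  moreover have "exp (- (norm x)\<^sup>2 / 4) = (\<Prod>b\<in>Basis. exp (- (x \<bullet> b)\<^sup>2 / 4))" for x :: 'a
    by (simp add: exp_sum[symmetric] norm_sq_Basis sum_divide_distrib sum_negf)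
  ultimately have fin: "(\<integral>\<^sup>+x. ennreal (exp (- (norm (x :: 'a))\<^sup>2 / 4)) \<partial>lborel) < \<infinity>"
    by (simp add: prod_ennreal[symmetric] power_less_top_ennreal
        nn_integral_lborel_prod[where f = "\<lambda>_ t. ennreal (exp (- (t\<^sup>2 / 4)))"])
  then have int: "integrable lborel (\<lambda>x :: 'a. exp (- (norm x)\<^sup>2 / 4))"
    by (simp add: integrable_iff_bounded)
  have "integrable lborel (\<lambda>x :: 'a. exp (a * norm x) * gauss_dens x)"
  proof (rule Bochner_Integration.integrable_bound)
    show "integrable lborel (\<lambda>x :: 'a. (2 * pi) powr (- real DIM('a) / 2) * exp (a\<^sup>2) * exp (- (norm x)\<^sup>2 / 4))"
      using int by (rule integrable_mult_right)
    have "exp (a * norm x) * exp (- (norm x)\<^sup>2 / 2) \<le> exp (a\<^sup>2) * exp (- (norm x)\<^sup>2 / 4)" for x :: 'a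
    proof -
      have "a * norm x \<le> a\<^sup>2 + (norm x)\<^sup>2 / 4"
        using zero_le_power2[of "a - norm x / 2"] by (simp add: power2_diff power_divide algebra_simps)
      then show ?thesis by (simp add: exp_add[symmetric])
    qed
    then show "AE x :: 'a in lborel. norm (exp (a * norm x) * gauss_dens x)
        \<le> norm ((2 * pi) powr (- real DIM('a) / 2) * exp (a\<^sup>2) * exp (- (norm x)\<^sup>2 / 4))"
      by (auto simp: gauss_dens_def intro!: AE_I2 mult_left_mono mult.left_commute[THEN ord_eq_le_trans]
          simp del: mult_exp_exp simp: mult.assoc)
  qed measurable
  then show ?thesis by (subst integrable_gauss_meas_iff) auto
qed

lemma integrable_gauss_bound:
  fixes g :: "'a :: euclidean_space \<Rightarrow> real"
  assumes "g \<in> borel_measurable borel" and "\<And>x. \<bar>g x\<bar> \<le> C * exp (a * norm x)"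
  shows "integrable gauss_meas g"
proof (rule Bochner_Integration.integrable_bound)
  show "integrable gauss_meas (\<lambda>x. C * exp (a * norm x))"
    by (intro integrable_mult_right integrable_exp_norm)
  show "AE x in gauss_meas. norm (g x) \<le> norm (C * exp (a * norm x))"
    using assms(2) by (intro AE_I2) (metis abs_ge_self order_trans real_norm_def)
qed (use assms in measurable)

text \<open>An independent pair is itself a standard Gaussian vector, so its invariance can be
  checked on a single density of the norm.\<close>

lemma pair_gauss_meas:
  "(gauss_meas :: 'a :: euclidean_space measure) \<Otimes>\<^sub>M (gauss_meas :: 'b :: euclidean_space measure) = gauss_meas"
proof -
  have "gauss_meas \<Otimes>\<^sub>M gauss_meas =
      density (lborel \<Otimes>\<^sub>M lborel) (\<lambda>(x :: 'a, y :: 'b). ennreal (gauss_dens x) * ennreal (gauss_dens y))"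
    unfolding gauss_meas_def
    by (intro pair_measure_density) (auto simp: gauss_meas_def[symmetric] gauss.sigma_finite_measure_axioms lborel.sigma_finite_measure_axioms)
  also have "\<dots> = gauss_meas"
    by (simp add: lborel_prod gauss_meas_def split_beta' ennreal_mult[symmetric] gauss_dens_Pair[symmetric])
  finally show ?thesis .
qed

section \<open>Invariance of an independent Gaussian pair under resampling\<close>

lemma nn_integral_lborel_translate:
  fixes h :: "'a :: euclidean_space \<Rightarrow> ennreal"
  assumes [measurable]: "h \<in> borel_measurable borel"
  shows "(\<integral>\<^sup>+x. h (x + c) \<partial>lborel) = (\<integral>\<^sup>+x. h x \<partial>lborel)"
proof -
  have "(\<integral>\<^sup>+x. h x \<partial>lborel) = (\<integral>\<^sup>+x. h x \<partial>distr lborel borel ((+) c))"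
    by (simp add: lborel_distr_plus)
  then show ?thesis
    by (simp add: nn_integral_distr add.commute)
qed

lemma nn_integral_lborel_uminus:
  fixes h :: "'a :: euclidean_space \<Rightarrow> ennreal"
  assumes [measurable]: "h \<in> borel_measurable borel"
  shows "(\<integral>\<^sup>+x. h (- x) \<partial>lborel) = (\<integral>\<^sup>+x. h x \<partial>lborel)"
  by (subst (2) lborel_affine[of "-1 :: real" 0]) (simp_all add: nn_integral_density nn_integral_distr)

lemma nn_integral_lborel_fst:
  fixes H :: "'a :: euclidean_space \<times> 'b :: euclidean_space \<Rightarrow> ennreal"
  assumes [measurable]: "H \<in> borel_measurable borel"
  shows "(\<integral>\<^sup>+p. H p \<partial>lborel) = (\<integral>\<^sup>+x. \<integral>\<^sup>+z. H (x, z) \<partial>lborel \<partial>lborel)"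
proof -
  have "H \<in> borel_measurable (lborel \<Otimes>\<^sub>M lborel)"
    by (simp add: lborel_prod)
  then show ?thesis
    by (subst lborel_prod[symmetric]) (simp add: lborel.nn_integral_fst)
qed

lemma nn_integral_lborel_snd:
  fixes H :: "'a :: euclidean_space \<times> 'b :: euclidean_space \<Rightarrow> ennreal"
  assumes [measurable]: "H \<in> borel_measurable borel"
  shows "(\<integral>\<^sup>+p. H p \<partial>lborel) = (\<integral>\<^sup>+z. \<integral>\<^sup>+x. H (x, z) \<partial>lborel \<partial>lborel)"
proof -
  have "H \<in> borel_measurable (lborel \<Otimes>\<^sub>M lborel)"
    by (simp add: lborel_prod)
  then show ?thesis
    by (subst lborel_prod[symmetric]) (simp add: lborel_pair.nn_integral_snd)
qed

text \<open>The map is the product of the shears \<open>(x, z) \<mapsto> (x + A z, z)\<close>, \<open>(x, z) \<mapsto> (x, z - B x)\<close>,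
  \<open>(x, z) \<mapsto> (x + A z, z)\<close> and the reflection \<open>(x, z) \<mapsto> (x, - z)\<close>.\<close>

lemma nn_integral_lborel_swap:
  fixes H :: "'a :: euclidean_space \<times> 'b :: euclidean_space \<Rightarrow> ennreal"
    and A :: "'b \<Rightarrow> 'a" and B :: "'a \<Rightarrow> 'b"
  assumes H [measurable]: "H \<in> borel_measurable borel"
    and A: "linear A" and B: "linear B" and BA: "\<And>z. B (A z) = z"
  shows "(\<integral>\<^sup>+p. H (fst p - A (B (fst p)) + A (snd p), B (fst p)) \<partial>lborel) = (\<integral>\<^sup>+p. H p \<partial>lborel)"
proof -
  have [measurable]: "A \<in> borel_measurable borel" "B \<in> borel_measurable borel"
    using A B by (auto intro!: borel_measurable_continuous_onI linear_continuous_on simp: linear_conv_bounded_linear)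
  have Hp [measurable]: "(\<lambda>p. H (u p, v p)) \<in> borel_measurable M"
    if "u \<in> borel_measurable M" "v \<in> borel_measurable M" for u v and M :: "'c measure"
    using that by (intro measurable_compose[OF _ H]) (simp add: borel_prod[symmetric])
  have sh1: "(\<integral>\<^sup>+p. K (fst p + A (snd p), snd p) \<partial>lborel) = (\<integral>\<^sup>+p. K p \<partial>lborel)"
    if K: "K \<in> borel_measurable borel" for K :: "'a \<times> 'b \<Rightarrow> ennreal"
  proof -
    have [measurable]: "K \<in> borel_measurable (borel \<Otimes>\<^sub>M borel)" using K by (simp add: borel_prod)
    have "(\<lambda>p. K (fst p + A (snd p), snd p)) \<in> borel_measurable borel"
      by (simp add: borel_prod[symmetric])
    then have "(\<integral>\<^sup>+p. K (fst p + A (snd p), snd p) \<partial>lborel) = (\<integral>\<^sup>+z. \<integral>\<^sup>+x. K (x + A z, z) \<partial>lborel \<partial>lborel)"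
      by (simp add: nn_integral_lborel_snd)
    also have "\<dots> = (\<integral>\<^sup>+z. \<integral>\<^sup>+x. K (x, z) \<partial>lborel \<partial>lborel)"
      by (intro nn_integral_cong nn_integral_lborel_translate) simp
    also have "\<dots> = (\<integral>\<^sup>+p. K p \<partial>lborel)"
      using K by (simp add: nn_integral_lborel_snd)
    finally show ?thesis .
  qed
  have sh2: "(\<integral>\<^sup>+p. K (fst p, snd p - B (fst p)) \<partial>lborel) = (\<integral>\<^sup>+p. K p \<partial>lborel)"
    if K: "K \<in> borel_measurable borel" for K :: "'a \<times> 'b \<Rightarrow> ennreal"
  proof -
    have [measurable]: "K \<in> borel_measurable (borel \<Otimes>\<^sub>M borel)" using K by (simp add: borel_prod)
    have "(\<lambda>p. K (fst p, snd p - B (fst p))) \<in> borel_measurable borel"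
      by (simp add: borel_prod[symmetric])
    then have "(\<integral>\<^sup>+p. K (fst p, snd p - B (fst p)) \<partial>lborel) = (\<integral>\<^sup>+x. \<integral>\<^sup>+z. K (x, z + - B x) \<partial>lborel \<partial>lborel)"
      by (simp add: nn_integral_lborel_fst)
    also have "\<dots> = (\<integral>\<^sup>+x. \<integral>\<^sup>+z. K (x, z) \<partial>lborel \<partial>lborel)"
      by (intro nn_integral_cong nn_integral_lborel_translate) simp
    also have "\<dots> = (\<integral>\<^sup>+p. K p \<partial>lborel)"
      using K by (simp add: nn_integral_lborel_fst)
    finally show ?thesis .
  qed
  have sh3: "(\<integral>\<^sup>+p. K (fst p, - snd p) \<partial>lborel) = (\<integral>\<^sup>+p. K p \<partial>lborel)"
    if K: "K \<in> borel_measurable borel" for K :: "'a \<times> 'b \<Rightarrow> ennreal"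
  proof -
    have [measurable]: "K \<in> borel_measurable (borel \<Otimes>\<^sub>M borel)" using K by (simp add: borel_prod)
    have "(\<lambda>p. K (fst p, - snd p)) \<in> borel_measurable borel"
      by (simp add: borel_prod[symmetric])
    then have "(\<integral>\<^sup>+p. K (fst p, - snd p) \<partial>lborel) = (\<integral>\<^sup>+x. \<integral>\<^sup>+z. K (x, - z) \<partial>lborel \<partial>lborel)"
      by (simp add: nn_integral_lborel_fst)
    also have "\<dots> = (\<integral>\<^sup>+x. \<integral>\<^sup>+z. K (x, z) \<partial>lborel \<partial>lborel)"
      by (intro nn_integral_cong nn_integral_lborel_uminus) simp
    also have "\<dots> = (\<integral>\<^sup>+p. K p \<partial>lborel)"
      using K by (simp add: nn_integral_lborel_fst)
    finally show ?thesis .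
  qed
  have [measurable]: "H \<in> borel_measurable (borel \<Otimes>\<^sub>M borel)" using H by (simp add: borel_prod)
  \<comment> \<open>Because \<open>B (A z) = z\<close>, the second shear removes exactly the
    \<open>z\<close> that the first one contributed, leaving \<open>- B x\<close>; the reflection
    corrects the sign.\<close>
  have alg: "x + A z + A (z - B (x + A z)) = x - A (B x) + A z" "- (z - B (x + A z)) = B x" for x z
    using BA by (simp_all add: linear_add[OF A] linear_add[OF B] linear_diff[OF A] linear_neg[OF A])
  have "(\<integral>\<^sup>+p. H p \<partial>lborel) = (\<integral>\<^sup>+p. H (fst p, - snd p) \<partial>lborel)"
    by (rule sh3[symmetric]) simp
  also have "\<dots> = (\<integral>\<^sup>+p. H (fst p + A (snd p), - snd p) \<partial>lborel)"
    by (subst sh1[symmetric]) (simp_all add: borel_prod[symmetric])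
  also have "\<dots> = (\<integral>\<^sup>+p. H (fst p + A (snd p - B (fst p)), - (snd p - B (fst p))) \<partial>lborel)"
    by (subst sh2[symmetric]) (simp_all add: borel_prod[symmetric])
  also have "\<dots> = (\<integral>\<^sup>+p. H (fst p + A (snd p) + A (snd p - B (fst p + A (snd p))),
      - (snd p - B (fst p + A (snd p)))) \<partial>lborel)"
    by (subst sh1[symmetric]) (simp_all add: borel_prod[symmetric])
  finally show ?thesis
    unfolding alg by simp
qed

text \<open>Lebesgue measure is preserved, and the density depends on the norm alone. The norm is
  kept because \<open>B\<close> is the adjoint of \<open>A\<close> and \<open>B (A z) = z\<close>:
  \<open>x - A (B x)\<close> is orthogonal to the range of \<open>A\<close>, and \<open>A\<close> is
  isometric, so the squared norm of the image is that of \<open>x - A (B x)\<close> plus those of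
  \<open>z\<close> and \<open>B x\<close>.\<close>

lemma distr_gauss_swap:
  fixes A :: "'b :: euclidean_space \<Rightarrow> 'a :: euclidean_space" and B :: "'a \<Rightarrow> 'b"
  assumes A: "linear A" and B: "linear B" and BA: "\<And>z. B (A z) = z"
    and adj: "\<And>x z. x \<bullet> A z = B x \<bullet> z"
  shows "distr gauss_meas borel (\<lambda>p. (fst p - A (B (fst p)) + A (snd p), B (fst p))) = gauss_meas"
proof (rule measure_eqI)
  let ?T = "\<lambda>p. (fst p - A (B (fst p)) + A (snd p), B (fst p))"
  have [measurable]: "A \<in> borel_measurable borel" "B \<in> borel_measurable borel"
    using A B by (auto intro!: borel_measurable_continuous_onI linear_continuous_on simp: linear_conv_bounded_linear)
  have T [measurable]: "?T \<in> borel_measurable borel"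
    by (simp add: borel_prod[symmetric])
  have norm_T: "(norm (?T p))\<^sup>2 = (norm p)\<^sup>2" for p
  proof -
    have adj': "A z \<bullet> x = z \<bullet> B x" for x z
      using adj[of x z] by (simp add: inner_commute)
    show ?thesis
      unfolding power2_norm_eq_inner inner_prod_def
      by (simp add: inner_add_left inner_add_right inner_diff_left inner_diff_right
          adj adj' BA linear_add[OF B] linear_diff[OF B] inner_commute[of "snd p" "B (fst p)"])
  qed
  have g: "gauss_dens (?T p) = gauss_dens p" for p
    by (simp only: gauss_dens_def norm_T)
  fix S assume "S \<in> sets (distr gauss_meas borel ?T)"
  then have S [measurable]: "S \<in> sets borel" by simp
  have "emeasure (distr gauss_meas borel ?T) S = (\<integral>\<^sup>+p. indicator S p \<partial>distr gauss_meas borel ?T)"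
    by simp
  also have "\<dots> = (\<integral>\<^sup>+p. indicator S (?T p) \<partial>gauss_meas)"
    by (rule nn_integral_distr) auto
  also have "\<dots> = (\<integral>\<^sup>+p. ennreal (gauss_dens (?T p)) * indicator S (?T p) \<partial>lborel)"
    unfolding g unfolding gauss_meas_def by (rule nn_integral_density) auto
  also have "\<dots> = (\<integral>\<^sup>+p. ennreal (gauss_dens p) * indicator S p \<partial>lborel)"
    by (rule nn_integral_lborel_swap[OF _ A B BA, of "\<lambda>p. ennreal (gauss_dens p) * indicator S p"]) simp
  also have "\<dots> = emeasure gauss_meas S"
    unfolding gauss_meas_def by (simp add: emeasure_density)
  finally show "emeasure (distr gauss_meas borel ?T) S = emeasure gauss_meas S" .
qed simp

lemma gauss_swap:
  fixes A :: "'b :: euclidean_space \<Rightarrow> 'a :: euclidean_space" and B :: "'a \<Rightarrow> 'b"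
    and H :: "'a \<times> 'b \<Rightarrow> real"
  assumes A: "linear A" and B: "linear B" and BA: "\<And>z. B (A z) = z"
    and adj: "\<And>x z. x \<bullet> A z = B x \<bullet> z"
    and H: "integrable gauss_meas H"
  shows "integrable gauss_meas (\<lambda>p. H (fst p - A (B (fst p)) + A (snd p), B (fst p)))"
    and "(LINT p|gauss_meas. H (fst p - A (B (fst p)) + A (snd p), B (fst p))) = (LINT p|gauss_meas. H p)"
proof -
  have [measurable]: "A \<in> borel_measurable borel" "B \<in> borel_measurable borel"
    using A B by (auto intro!: borel_measurable_continuous_onI linear_continuous_on simp: linear_conv_bounded_linear)
  have "(\<lambda>p. (fst p - A (B (fst p)) + A (snd p), B (fst p))) \<in> borel_measurable borel"
    by (simp add: borel_prod[symmetric])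
  then have T: "(\<lambda>p. (fst p - A (B (fst p)) + A (snd p), B (fst p))) \<in> borel_measurable gauss_meas"
    by simp
  have Hm: "H \<in> borel_measurable borel"
    using borel_measurable_integrable[OF H] by simp
  show "integrable gauss_meas (\<lambda>p. H (fst p - A (B (fst p)) + A (snd p), B (fst p)))"
    using integrable_distr[OF T, of H] H unfolding distr_gauss_swap[OF A B BA adj] by simp
  show "(LINT p|gauss_meas. H (fst p - A (B (fst p)) + A (snd p), B (fst p))) = (LINT p|gauss_meas. H p)"
    using integral_distr[OF T Hm] unfolding distr_gauss_swap[OF A B BA adj] by simp
qed

lemma gauss_Fubini:
  fixes H :: "'a :: euclidean_space \<times> 'b :: euclidean_space \<Rightarrow> real"
  assumes "integrable gauss_meas H"
  shows "integrable gauss_meas (\<lambda>x. LINT z|gauss_meas. H (x, z))"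
    and "(LINT x|gauss_meas. LINT z|gauss_meas. H (x, z)) = (LINT p|gauss_meas. H p)"
proof -
  interpret pair_prob_space "gauss_meas :: 'a measure" "gauss_meas :: 'b measure" ..
  show "integrable gauss_meas (\<lambda>x. LINT z|gauss_meas. H (x, z))"
    and "(LINT x|gauss_meas. LINT z|gauss_meas. H (x, z)) = (LINT p|gauss_meas. H p)"
    using integrable_fst'[of H] integral_fst'[of H] assms by (simp_all add: pair_gauss_meas)
qed

section \<open>Stein's identity\<close>

lemma lborel_translate:
  fixes h :: "'a :: euclidean_space \<Rightarrow> real"
  assumes "integrable lborel h"
  shows "integrable lborel (\<lambda>x. h (x + c))" and "(LINT x|lborel. h (x + c)) = (LINT x|lborel. h x)"
proof -
  have [measurable]: "h \<in> borel_measurable borel"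
    using assms by auto
  have "(\<lambda>x. x + c) = (+) c" by auto
  then have d: "distr lborel borel (\<lambda>x. x + c) = (lborel :: 'a measure)"
    by (simp add: lborel_distr_plus)
  show "integrable lborel (\<lambda>x. h (x + c))"
    using integrable_distr[of "\<lambda>x. x + c" lborel borel h] assms unfolding d by simp
  show "(LINT x|lborel. h (x + c)) = (LINT x|lborel. h x)"
    using integral_distr[of "\<lambda>x. x + c" lborel borel h] unfolding d by simp
qed

lemma abs_exp_minus_one_le: "\<bar>exp u - 1\<bar> \<le> \<bar>u\<bar> * exp \<bar>u\<bar>" for u :: real
proof (cases "u \<ge> 0")
  case True
  have "1 - u \<le> exp (- u)" using exp_ge_add_one_self[of "- u"] by simp
  then have "(1 - u) * exp u \<le> exp (- u) * exp u" by (intro mult_right_mono) auto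
  then have "exp u - 1 \<le> u * exp u" by (simp add: algebra_simps exp_minus)
  with True show ?thesis by simp
next
  case False
  then have "exp u \<le> 1" by simp
  with False have "\<bar>exp u - 1\<bar> \<le> \<bar>u\<bar> * 1" using exp_ge_add_one_self[of u] by linarith
  also have "\<dots> \<le> \<bar>u\<bar> * exp \<bar>u\<bar>" by (intro mult_left_mono) auto
  finally show ?thesis .
qed

lemma lipschitz_on_UNIV_growth:
  fixes \<phi> :: "'a :: real_normed_vector \<Rightarrow> real"
  assumes "lipschitz_on K UNIV \<phi>"
  shows "\<bar>\<phi> z\<bar> \<le> \<bar>\<phi> 0\<bar> + K * norm z"
  using lipschitz_onD[OF assms, of z 0] by (auto simp: dist_norm)

text \<open>Stein's identity: differentiate at \<open>t = 0\<close> the constant function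
  \<open>t \<mapsto> \<integral> \<phi> (z + t b) gauss_dens (z + t b) dz\<close>.\<close>

lemma gauss_Stein:
  fixes \<phi> :: "'a :: euclidean_space \<Rightarrow> real"
  assumes der: "\<And>z. (\<phi> has_derivative D z) (at z)"
    and lip: "lipschitz_on K UNIV \<phi>"
    and b: "norm b = 1"
  shows "integrable gauss_meas (\<lambda>z. \<phi> z * (z \<bullet> b))"
    and "integrable gauss_meas (\<lambda>z. D z b)"
    and "(LINT z|gauss_meas. \<phi> z * (z \<bullet> b)) = (LINT z|gauss_meas. D z b)"
proof -
  let ?G = "gauss_dens :: 'a \<Rightarrow> real"
  have K: "0 \<le> K" using lip by (rule lipschitz_on_nonneg)
  have \<phi>m [measurable]: "\<phi> \<in> borel_measurable borel"
    using lipschitz_on_continuous_on[OF lip] by (rule borel_measurable_continuous_onI)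
  \<comment> \<open>One constant that serves as a Lipschitz constant and, together with
    \<open>exp (norm z)\<close>, as a growth bound.\<close>
  define c where "c = K + \<bar>\<phi> 0\<bar>"
  have c: "0 \<le> c" "K \<le> c" using K by (auto simp: c_def)
  have growth: "\<bar>\<phi> z\<bar> \<le> c * exp (norm z)" for z
  proof -
    have "\<bar>\<phi> z\<bar> \<le> \<bar>\<phi> 0\<bar> * 1 + K * norm z"
      using lipschitz_on_UNIV_growth[OF lip, of z] by simp
    also have "\<dots> \<le> \<bar>\<phi> 0\<bar> * exp (norm z) + K * exp (norm z)"
      using K exp_ge_add_one_self[of "norm z"]
      by (intro add_mono mult_left_mono) (auto simp del: exp_ge_add_one_self)
    finally show ?thesis by (simp add: c_def algebra_simps)
  qed
  have "integrable gauss_meas \<phi>"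
    by (rule integrable_gauss_bound[where C = c and a = 1]) (simp_all add: growth)
  then have int\<phi>: "integrable lborel (\<lambda>z. \<phi> z * ?G z)"
    by (subst (asm) integrable_gauss_meas_iff) auto
  show int1: "integrable gauss_meas (\<lambda>z. \<phi> z * (z \<bullet> b))"
  proof (rule integrable_gauss_bound[where C = c and a = 2])
    fix z :: 'a
    have "\<bar>z \<bullet> b\<bar> \<le> exp (norm z)"
      using Cauchy_Schwarz_ineq2[of z b] exp_ge_add_one_self[of "norm z"] unfolding b by linarith
    then have "\<bar>\<phi> z\<bar> * \<bar>z \<bullet> b\<bar> \<le> c * exp (norm z) * exp (norm z)"
      using growth[of z] c by (intro mult_mono) auto
    then show "\<bar>\<phi> z * (z \<bullet> b)\<bar> \<le> c * exp (2 * norm z)"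
      by (simp add: abs_mult exp_double power2_eq_square mult.assoc)
  qed measurable
  have int1': "integrable lborel (\<lambda>z. \<phi> z * (z \<bullet> b) * ?G z)"
    using int1 by (subst (asm) integrable_gauss_meas_iff) auto
  define H where "H t z = \<phi> (z + t *\<^sub>R b) * ?G (z + t *\<^sub>R b)" for t z
  \<comment> \<open>The increment of \<open>H\<close> splits into the increment of
    \<open>\<phi>\<close> times \<open>exp u\<close> and \<open>\<phi>\<close> times
    \<open>exp u - 1\<close>. With \<open>e = exp (norm z + 1)\<close> each part is at most
    \<open>c * \<bar>t\<bar> * e ^ 3\<close> times the density, whence the factor 2 and the
    exponents 3.\<close>
  define g where "g z = 2 * c * exp 3 * (exp (3 * norm z) * ?G z)" for z
  have G: "?G (z + t *\<^sub>R b) = ?G z * exp (- t * (z \<bullet> b) - t\<^sup>2 / 2)" for z t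
  proof -
    have "(norm (z + t *\<^sub>R b))\<^sup>2 = (norm z)\<^sup>2 + 2 * t * (z \<bullet> b) + t\<^sup>2"
      unfolding power2_norm_eq_inner
      using b by (simp add: inner_add_left inner_add_right inner_commute[of b z] norm_eq_1 power2_eq_square algebra_simps)
    then have "- (norm (z + t *\<^sub>R b))\<^sup>2 / 2 = - (norm z)\<^sup>2 / 2 + (- t * (z \<bullet> b) - t\<^sup>2 / 2)"
      by (simp add: field_simps)
    then show ?thesis
      unfolding gauss_dens_def by (simp only: exp_add mult_ac)
  qed
  have lipH: "\<bar>H t z - H 0 z\<bar> \<le> g z * \<bar>t\<bar>" if t: "\<bar>t\<bar> < 1" for t z
  proof -
    define n where "n = norm z"
    define u where "u = - t * (z \<bullet> b) - t\<^sup>2 / 2"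
    define e where "e = exp (n + 1)"
    have n: "n \<ge> 0" by (simp add: n_def)
    have "\<bar>u\<bar> \<le> \<bar>t\<bar> * \<bar>z \<bullet> b\<bar> + \<bar>t\<bar> * \<bar>t\<bar> / 2"
      unfolding u_def using abs_triangle_ineq4[of "- t * (z \<bullet> b)" "t\<^sup>2 / 2"] 
      by (simp add: abs_mult power2_eq_square)
    also have "\<dots> \<le> \<bar>t\<bar> * n + \<bar>t\<bar> * 1"
      using t b Cauchy_Schwarz_ineq2[of z b] mult_left_mono[of "\<bar>t\<bar>" 1 "\<bar>t\<bar>"]
      by (intro add_mono mult_left_mono) (auto simp: n_def)
    finally have u: "\<bar>u\<bar> \<le> \<bar>t\<bar> * (n + 1)" by (simp add: algebra_simps)
    also have "\<dots> \<le> 1 * (n + 1)" using t n by (intro mult_right_mono) auto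
    finally have u1: "\<bar>u\<bar> \<le> n + 1" by simp
    have e1: "n + 1 \<le> e" "1 \<le> e" using exp_ge_add_one_self[of "n + 1"] n by (auto simp: e_def)
    have eu: "exp u \<le> e" "exp \<bar>u\<bar> \<le> e" using u1 by (auto simp: e_def)
    have "\<bar>exp u - 1\<bar> \<le> \<bar>u\<bar> * exp \<bar>u\<bar>" by (rule abs_exp_minus_one_le)
    also have "\<dots> \<le> (\<bar>t\<bar> * (n + 1)) * e"
      using u eu n by (intro mult_mono) auto
    also have "\<dots> \<le> (\<bar>t\<bar> * e) * e"
      using e1 by (intro mult_right_mono mult_left_mono) auto
    finally have d2: "\<bar>exp u - 1\<bar> \<le> \<bar>t\<bar> * e * e" .
    have d1: "\<bar>\<phi> (z + t *\<^sub>R b) - \<phi> z\<bar> \<le> c * \<bar>t\<bar>"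
    proof -
      have "\<bar>\<phi> (z + t *\<^sub>R b) - \<phi> z\<bar> \<le> K * \<bar>t\<bar>"
        using lipschitz_onD[OF lip, of "z + t *\<^sub>R b" z] b by (simp add: dist_norm)
      also have "\<dots> \<le> c * \<bar>t\<bar>" using c by (intro mult_right_mono) auto
      finally show ?thesis .
    qed
    have d3: "\<bar>\<phi> z\<bar> \<le> c * e"
    proof -
      have "c * exp (norm z) \<le> c * e" using c by (intro mult_left_mono) (auto simp: e_def n_def)
      then show ?thesis using growth[of z] by simp
    qed
    have "H t z - H 0 z = ((\<phi> (z + t *\<^sub>R b) - \<phi> z) * exp u + \<phi> z * (exp u - 1)) * ?G z"
      by (simp add: H_def G u_def algebra_simps)
    then have "\<bar>H t z - H 0 z\<bar> = \<bar>(\<phi> (z + t *\<^sub>R b) - \<phi> z) * exp u + \<phi> z * (exp u - 1)\<bar> * ?G z"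
      by (simp add: abs_mult)
    also have "\<dots> \<le> (\<bar>\<phi> (z + t *\<^sub>R b) - \<phi> z\<bar> * exp u + \<bar>\<phi> z\<bar> * \<bar>exp u - 1\<bar>) * ?G z"
      by (intro mult_right_mono order_trans[OF abs_triangle_ineq]) (auto simp: abs_mult)
    also have "\<dots> \<le> ((c * \<bar>t\<bar>) * e + (c * e) * (\<bar>t\<bar> * e * e)) * ?G z"
      using d1 d2 d3 eu c e1 by (intro mult_right_mono add_mono mult_mono) auto
    also have "\<dots> \<le> ((c * \<bar>t\<bar>) * (e * e * e) + (c * e) * (\<bar>t\<bar> * e * e)) * ?G z"
    proof -
      have "e * 1 * 1 \<le> e * e * e" using e1 by (intro mult_mono) auto
      then show ?thesis using c e1 by (intro mult_right_mono add_mono mult_left_mono) auto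
    qed
    also have "\<dots> = g z * \<bar>t\<bar>"
    proof -
      have "exp 3 * exp (3 * n) = e * e * e"
        by (simp add: e_def mult_exp_exp)
      then have gz: "g z = 2 * c * (e * e * e) * ?G z" by (simp add: g_def n_def)
      show ?thesis unfolding gz by (simp add: algebra_simps)
    qed
    finally show ?thesis .
  qed
  have derH: "((\<lambda>t. H t z) has_real_derivative (D z b - \<phi> z * (z \<bullet> b)) * ?G z) (at 0)" for z
  proof -
    have "((\<lambda>t. \<phi> (z + t *\<^sub>R b)) has_derivative (\<lambda>t. D z (t *\<^sub>R b))) (at 0)"
      by (rule has_derivative_compose[where g = \<phi>]) (auto intro!: derivative_eq_intros simp: der)
    moreover have "D z (t *\<^sub>R b) = t * D z b" for t
      using linear_scale[OF has_derivative_linear[OF der[of z]]] by simp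
    ultimately have "((\<lambda>t. \<phi> (z + t *\<^sub>R b)) has_real_derivative D z b) (at 0)"
      by (simp add: has_field_derivative_def mult.commute[of _ "D z b"])
    then show ?thesis
      unfolding H_def G by (auto intro!: derivative_eq_intros simp: algebra_simps)
  qed
  have intH: "integrable lborel (H t)" and eqH: "(LINT z|lborel. H t z) = (LINT z|lborel. H 0 z)" for t
    using lborel_translate[OF int\<phi>, of "t *\<^sub>R b"] by (simp_all add: H_def[abs_def])
  have intg: "integrable lborel g"
    unfolding g_def using integrable_exp_norm[where 'a = 'a, of 3]
    by (intro integrable_mult_right) (simp add: integrable_gauss_meas_iff)
  note L = has_real_derivative_integral[OF intH intg lipH derH]
  have "((\<lambda>t. LINT z|lborel. H t z) has_real_derivative 0) (at 0)"
    by (subst eqH) simp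
  then have zero: "(LINT z|lborel. (D z b - \<phi> z * (z \<bullet> b)) * ?G z) = 0"
    using L(2) DERIV_unique by blast
  have intD: "integrable lborel (\<lambda>z. D z b * ?G z)"
    using Bochner_Integration.integrable_add[OF L(1) int1'] by (simp add: algebra_simps)
  \<comment> \<open>The dominated limit is measurable only together with the density; division by
    the strictly positive density recovers \<open>D z b\<close> itself.\<close>
  have "(\<lambda>z. D z b * ?G z / ?G z) \<in> borel_measurable borel"
    using intD by measurable
  moreover have "?G z \<noteq> 0" for z by (simp add: gauss_dens_def)
  ultimately have Dm: "(\<lambda>z. D z b) \<in> borel_measurable borel" by simp
  then show "integrable gauss_meas (\<lambda>z. D z b)"
    using intD by (simp add: integrable_gauss_meas_iff)
  show "(LINT z|gauss_meas. \<phi> z * (z \<bullet> b)) = (LINT z|gauss_meas. D z b)"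
    using zero intD int1' by (simp add: integral_gauss_meas Dm left_diff_distrib)
qed

section \<open>Integrability from polynomial growth, and square inequalities\<close>

lemma integrable_gauss_poly:
  fixes g :: "'a :: euclidean_space \<Rightarrow> real"
  assumes "g \<in> borel_measurable borel" and bound: "\<And>x. \<bar>g x\<bar> \<le> c * (1 + norm x) ^ n"
  shows "integrable gauss_meas g"
proof (rule integrable_gauss_bound[where C = c and a = "real n"])
  have c: "0 \<le> c" using bound[of 0] by simp
  fix x :: 'a
  have "(1 + norm x) ^ n \<le> exp (norm x) ^ n"
    using exp_ge_add_one_self[of "norm x"] by (intro power_mono) auto
  then have "c * (1 + norm x) ^ n \<le> c * exp (real n * norm x)"
    using c by (intro mult_left_mono) (simp_all add: exp_of_nat_mult)
  then show "\<bar>g x\<bar> \<le> c * exp (real n * norm x)"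
    using bound[of x] by simp
qed fact

lemma integrable_gauss_poly_pair:
  fixes g :: "'a :: euclidean_space \<times> 'b :: euclidean_space \<Rightarrow> real"
  assumes "g \<in> borel_measurable borel"
    and bound: "\<And>x z. \<bar>g (x, z)\<bar> \<le> c * (1 + norm x) ^ m * (1 + norm z) ^ n"
  shows "integrable gauss_meas g"
proof (rule integrable_gauss_poly[where c = c and n = "m + n"])
  have c: "0 \<le> c" using bound[of 0 0] by simp
  fix p :: "'a \<times> 'b"
  obtain x z where p: "p = (x, z)" by (cases p)
  have "norm x \<le> norm p" "norm z \<le> norm p"
    using norm_fst_le[of x z] norm_snd_le[of z x] by (auto simp: p)
  then have "c * (1 + norm x) ^ m * (1 + norm z) ^ n \<le> c * (1 + norm p) ^ m * (1 + norm p) ^ n"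
    using c by (intro mult_mono power_mono) auto
  then show "\<bar>g p\<bar> \<le> c * (1 + norm p) ^ (m + n)"
    using bound[of x z] by (simp add: p power_add mult.assoc)
qed fact

lemma borel_measurable_matrix_vector_mult [measurable (raw)]:
  fixes V :: "real^'k^'m"
  assumes "g \<in> borel_measurable M"
  shows "(\<lambda>x. V *v g x) \<in> borel_measurable M"
  by (rule measurable_compose[OF assms]) (intro borel_measurable_continuous_onI
      linear_continuous_on matrix_vector_mul_bounded_linear)

lemma borel_measurable_vec_nth' [measurable (raw)]:
  fixes g :: "'a \<Rightarrow> real^'k"
  assumes "g \<in> borel_measurable M"
  shows "(\<lambda>x. g x $ j) \<in> borel_measurable M"
  by (rule measurable_compose[OF assms]) (intro borel_measurable_continuous_onI continuous_intros)

lemma borel_measurable_fst_borel [measurable (raw)]: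
  fixes g :: "'a \<Rightarrow> 'b :: topological_space \<times> 'c :: topological_space"
  assumes "g \<in> borel_measurable M"
  shows "(\<lambda>x. fst (g x)) \<in> borel_measurable M"
  by (rule measurable_compose[OF assms]) (intro borel_measurable_continuous_onI continuous_intros)

lemma borel_measurable_snd_borel [measurable (raw)]:
  fixes g :: "'a \<Rightarrow> 'b :: topological_space \<times> 'c :: topological_space"
  assumes "g \<in> borel_measurable M"
  shows "(\<lambda>x. snd (g x)) \<in> borel_measurable M"
  by (rule measurable_compose[OF assms]) (intro borel_measurable_continuous_onI continuous_intros)

text \<open>Moving in the direction \<open>d\<close> itself, the difference quotients tend to
  \<open>d \<bullet> d\<close> and are at most \<open>L * norm d\<close>.\<close>

lemma norm_gradient_le_lipschitz:
  fixes f :: "'a :: real_inner \<Rightarrow> real"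
  assumes der: "(f has_derivative (\<lambda>h. d \<bullet> h)) (at x)" and lip: "lipschitz_on L UNIV f"
  shows "norm d \<le> L"
proof -
  have "((\<lambda>t. f (x + t *\<^sub>R d)) has_derivative (\<lambda>t. d \<bullet> (t *\<^sub>R d))) (at 0)"
    by (rule has_derivative_compose[where g = f]) (auto intro!: derivative_eq_intros simp: der)
  then have "((\<lambda>t. f (x + t *\<^sub>R d)) has_real_derivative (d \<bullet> d)) (at 0)"
    by (simp add: has_field_derivative_def mult.commute[of _ "d \<bullet> d"])
  then have lim: "((\<lambda>t. (f (x + t *\<^sub>R d) - f x) / t) \<longlongrightarrow> d \<bullet> d) (at 0)"
    by (simp add: DERIV_def)
  have "\<forall>\<^sub>F t in at 0. (f (x + t *\<^sub>R d) - f x) / t \<le> L * norm d"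
  proof (rule eventually_at_ball'[of 1, THEN eventually_mono])
    fix t :: real assume "t \<in> ball 0 1 \<and> t \<noteq> 0 \<and> t \<in> UNIV"
    then have t: "t \<noteq> 0" by simp
    have "\<bar>f (x + t *\<^sub>R d) - f x\<bar> \<le> L * norm d * \<bar>t\<bar>"
      using lipschitz_onD[OF lip, of "x + t *\<^sub>R d" x] by (simp add: dist_norm mult_ac)
    then have "\<bar>(f (x + t *\<^sub>R d) - f x) / t\<bar> \<le> L * norm d"
      using t by (simp add: abs_divide divide_le_eq)
    then show "(f (x + t *\<^sub>R d) - f x) / t \<le> L * norm d"
      by (rule order_trans[OF abs_ge_self])
  qed simp
  then have "d \<bullet> d \<le> L * norm d"
    using lim by (intro tendsto_upperbound[OF lim]) auto
  then have "norm d * norm d \<le> L * norm d"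
    by (simp add: power2_norm_eq_inner[symmetric] power2_eq_square)
  then show ?thesis
    using lipschitz_on_nonneg[OF lip] by (cases "norm d = 0") auto
qed

text \<open>Nonnegativity of the variance; this is the instance of Jensen's inequality applied on
  each fibre.\<close>

lemma (in prob_space) integral_square_le:
  fixes X :: "'a \<Rightarrow> real"
  assumes "integrable M X" "integrable M (\<lambda>x. (X x)\<^sup>2)"
  shows "(LINT x|M. X x)\<^sup>2 \<le> (LINT x|M. (X x)\<^sup>2)"
  using variance_positive[of X] variance_eq[OF assms] by simp

text \<open>The integral of \<open>(u + s v)\<^sup>2\<close> is a quadratic polynomial in
  \<open>s\<close> that is never negative; its value at the vertex \<open>s = - b / c\<close> gives
  the inequality.\<close>

lemma integral_mult_square_le:
  fixes u v :: "'a \<Rightarrow> real"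
  assumes u: "integrable M (\<lambda>x. (u x)\<^sup>2)" and v: "integrable M (\<lambda>x. (v x)\<^sup>2)"
    and uv: "integrable M (\<lambda>x. u x * v x)"
  shows "(LINT x|M. u x * v x)\<^sup>2 \<le> (LINT x|M. (u x)\<^sup>2) * (LINT x|M. (v x)\<^sup>2)"
proof -
  define a where "a = (LINT x|M. (u x)\<^sup>2)"
  define b where "b = (LINT x|M. u x * v x)"
  define c where "c = (LINT x|M. (v x)\<^sup>2)"
  have q: "0 \<le> a + 2 * s * b + s\<^sup>2 * c" for s
  proof -
    have "0 \<le> (LINT x|M. (u x + s * v x)\<^sup>2)"
      by (rule integral_nonneg_AE) simp
    also have "(\<lambda>x. (u x + s * v x)\<^sup>2) = (\<lambda>x. (u x)\<^sup>2 + 2 * s * (u x * v x) + s\<^sup>2 * (v x)\<^sup>2)"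
      by (auto simp: power2_sum power_mult_distrib algebra_simps)
    also have "(LINT x|M. (u x)\<^sup>2 + 2 * s * (u x * v x) + s\<^sup>2 * (v x)\<^sup>2) = a + 2 * s * b + s\<^sup>2 * c"
      using u v uv by (simp add: a_def b_def c_def)
    finally show ?thesis .
  qed
  have c0: "0 \<le> c" unfolding c_def by (rule integral_nonneg_AE) simp
  have "b\<^sup>2 \<le> a * c"
  proof (cases "c = 0")
    case True
    have "b = 0"
    proof (rule ccontr)
      assume "b \<noteq> 0"
      \<comment> \<open>With \<open>c = 0\<close> the polynomial is affine, and this choice of
        \<open>s\<close> gives it the value \<open>-1\<close>.\<close>
      then show False using q[of "- (a + 1) / (2 * b)"] True by (simp add: field_simps)
    qed
    then show ?thesis using True by simp
  next
    case False
    with c0 have "c > 0" by simp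
    have "0 \<le> c * (a + 2 * (- b / c) * b + (- b / c)\<^sup>2 * c)"
      using q[of "- b / c"] c0 by (intro mult_nonneg_nonneg) auto
    also have "\<dots> = a * c - b\<^sup>2"
      using False by (simp add: field_simps power2_eq_square)
    finally show ?thesis by simp
  qed
  then show ?thesis by (simp add: a_def b_def c_def)
qed

section \<open>Averages over the fibres of an orthonormal frame\<close>

text \<open>The frame is arbitrary here; that its columns are eigenvectors enters at the end, when
  the integral of \<open>(Df x \<bullet> column j V)\<^sup>2\<close> is evaluated.\<close>

locale lipschitz_frame =
  fixes f :: "real^'m \<Rightarrow> real" and Df :: "real^'m \<Rightarrow> real^'m" and L :: real
    and V :: "real^'k^'m"
  assumes deriv: "\<And>x. (f has_derivative (\<lambda>h. Df x \<bullet> h)) (at x)"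
    and deriv_cont: "continuous_on UNIV Df"
    and lip: "lipschitz_on L UNIV f"
    and frame: "transpose V ** V = mat 1"
begin

definition coord :: "real^'m \<Rightarrow> real^'k" where
  "coord x = transpose V *v x"

definition mix :: "real^'m \<Rightarrow> real^'k \<Rightarrow> real^'m" where
  "mix x z = x - V *v coord x + V *v z"

definition mu :: "real^'m \<Rightarrow> real" where
  "mu x = (LINT z|gauss_meas. f (mix x z))"

text \<open>The fibre average of the gradient paired with a fixed \<open>w\<close>, so that all
  integrals stay scalar. In the end \<open>w\<close> is a row of the projection or a column of
  \<open>V\<close>.\<close>

definition dirav :: "real^'m \<Rightarrow> real^'m \<Rightarrow> real" where
  "dirav w x = (LINT z|gauss_meas. Df (mix x z) \<bullet> w)"

lemma L_nonneg: "0 \<le> L"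
  using lip by (rule lipschitz_on_nonneg)

lemma f_measurable [measurable]: "f \<in> borel_measurable borel"
  using lipschitz_on_continuous_on[OF lip] by (rule borel_measurable_continuous_onI)

lemma Df_measurable [measurable]: "Df \<in> borel_measurable borel"
  using deriv_cont by (rule borel_measurable_continuous_onI)

lemma linear_coord: "linear coord"
  unfolding coord_def[abs_def] by (rule matrix_vector_mul_linear)

lemma coord_measurable [measurable (raw)]:
  assumes [measurable]: "g \<in> borel_measurable M"
  shows "(\<lambda>x. coord (g x)) \<in> borel_measurable M"
  unfolding coord_def by measurable

lemma mix_measurable [measurable (raw)]:
  assumes [measurable]: "g \<in> borel_measurable M" "h \<in> borel_measurable M"
  shows "(\<lambda>x. mix (g x) (h x)) \<in> borel_measurable M"
  unfolding mix_def by measurable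

lemma norm_Df_le: "norm (Df x) \<le> L"
  by (rule norm_gradient_le_lipschitz[OF deriv lip])

lemma Df_inner_le: "\<bar>Df x \<bullet> w\<bar> \<le> L * norm w"
  using Cauchy_Schwarz_ineq2[of "Df x" w] norm_Df_le[of x] mult_right_mono[of "norm (Df x)" L "norm w"]
  by simp

lemma coord_frame [simp]: "coord (V *v z) = z"
  by (simp only: coord_def matrix_vector_mul_assoc frame matrix_vector_mul_lid)

lemma inner_frame: "x \<bullet> (V *v z) = coord x \<bullet> z"
  by (simp add: coord_def dot_lmul_matrix[symmetric])

lemma norm_frame [simp]: "norm (V *v z) = norm z"
  by (simp add: norm_eq_sqrt_inner inner_frame)

lemma norm_coord_le: "norm (coord x) \<le> norm x"
proof -
  have "norm (coord x) * norm (coord x) = x \<bullet> (V *v coord x)"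
    by (simp add: inner_frame power2_norm_eq_inner[symmetric] power2_eq_square[symmetric])
  also have "\<dots> \<le> norm x * norm (coord x)"
    using norm_cauchy_schwarz[of x "V *v coord x"] by simp
  finally show ?thesis
    by (cases "norm (coord x) = 0") auto
qed

lemma coord_mix [simp]: "coord (mix x z) = z"
  by (simp add: mix_def linear_add[OF linear_coord] linear_diff[OF linear_coord])

text \<open>Resampling twice retains only the last coordinate; hence everything averaged over a
  fibre, such as \<open>mu\<close> and \<open>dirav w\<close>, is constant along it.\<close>

lemma mix_mix [simp]: "mix (mix x z) z' = mix x z'"
  unfolding mix_def[of "mix x z" z'] coord_mix by (simp add: mix_def)

lemma inner_mix: "coord w = 0 \<Longrightarrow> mix x z \<bullet> w = x \<bullet> w"
  by (simp add: mix_def inner_commute[of _ w] inner_add_right inner_diff_right inner_frame)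

lemma norm_mix_le: "norm (mix x z) \<le> 2 * norm x + norm z"
  unfolding mix_def using norm_triangle_ineq[of "x - V *v coord x" "V *v z"]
    norm_triangle_ineq4[of x "V *v coord x"] norm_coord_le[of x] by simp

text \<open>Read from right to left, this replaces \<open>x\<close> by its resampled version and an
  independent \<open>z\<close> by the old coordinate. For \<open>H\<close> not depending on its
  second argument it says that \<open>mix x z\<close> has the law of \<open>x\<close>.\<close>

lemma mix_swap:
  assumes "integrable gauss_meas (\<lambda>p. H (fst p) (snd p))"
  shows "(LINT x|gauss_meas. LINT z|gauss_meas. H (mix x z) (coord x)) =
    (LINT x|gauss_meas. LINT z|gauss_meas. H x z :: real)"
proof -
  note * = gauss_swap[OF matrix_vector_mul_linear[of V] linear_coord
      coord_frame inner_frame assms]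
  show ?thesis
    using gauss_Fubini(2)[OF *(1)] gauss_Fubini(2)[OF assms] *(2) by (simp add: mix_def)
qed

lemma f_growth: "\<bar>f x\<bar> \<le> (\<bar>f 0\<bar> + L) * (1 + norm x)"
proof -
  have "(\<bar>f 0\<bar> + L) * (1 + norm x) = (\<bar>f 0\<bar> + L * norm x) + (L + \<bar>f 0\<bar> * norm x)"
    by (simp add: algebra_simps)
  then show ?thesis
    using lipschitz_on_UNIV_growth[OF lip, of x] L_nonneg
    by (smt (verit) mult_nonneg_nonneg norm_ge_zero)
qed

lemma mu_measurable [measurable]: "mu \<in> borel_measurable borel"
  unfolding mu_def[abs_def]
  by (rule gauss.borel_measurable_lebesgue_integral) (simp add: split_beta')

lemma dirav_measurable [measurable]: "dirav w \<in> borel_measurable borel"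
  unfolding dirav_def[abs_def]
  by (rule gauss.borel_measurable_lebesgue_integral) (simp add: split_beta')

lemma integrable_Df_mix: "integrable gauss_meas (\<lambda>z. Df (mix x z) \<bullet> w)"
  by (rule integrable_gauss_poly[where c = "L * norm w" and n = 0]) (simp_all add: Df_inner_le)

lemma dirav_le: "\<bar>dirav w x\<bar> \<le> L * norm w"
proof -
  have "\<bar>dirav w x\<bar> \<le> (LINT z|(gauss_meas :: (real^'k) measure). L * norm w)"
    unfolding dirav_def using integrable_Df_mix[of x w] Df_inner_le
    by (intro order_trans[OF integral_abs_bound] integral_mono) auto
  then show ?thesis by simp
qed

lemma dirav_mix [simp]: "dirav w (mix x z) = dirav w x"
  by (simp add: dirav_def)

lemma mu_mix [simp]: "mu (mix x z) = mu x"
  by (simp add: mu_def)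

lemma f_mix_le: "\<bar>f (mix x z)\<bar> \<le> (2 * (\<bar>f 0\<bar> + L)) * (1 + norm x) * (1 + norm z)"
proof -
  have "1 + norm (mix x z) \<le> 2 * ((1 + norm x) * (1 + norm z))"
    using norm_mix_le[of x z] by (simp add: algebra_simps)
      (smt (verit) mult_nonneg_nonneg norm_ge_zero)
  then have "(\<bar>f 0\<bar> + L) * (1 + norm (mix x z)) \<le> (\<bar>f 0\<bar> + L) * (2 * ((1 + norm x) * (1 + norm z)))"
    using L_nonneg by (intro mult_left_mono) auto
  then show ?thesis
    using f_growth[of "mix x z"] by (simp only: mult_ac)
qed

lemma integrable_f_mix: "integrable gauss_meas (\<lambda>z. f (mix x z))"
  by (rule integrable_gauss_poly[where c = "(2 * (\<bar>f 0\<bar> + L)) * (1 + norm x)" and n = 1])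
    (simp_all only: power_one_right f_mix_le, measurable)

lemma mu_growth: "\<exists>c \<ge> 0. \<forall>x. \<bar>mu x\<bar> \<le> c * (1 + norm x)"
proof -
  define m where "m = (LINT z|(gauss_meas :: (real^'k) measure). 1 + norm z)"
  have m: "integrable gauss_meas (\<lambda>z :: real^'k. 1 + norm z)"
    by (rule integrable_gauss_poly[where c = 1 and n = 1]) auto
  have m0: "0 \<le> m" unfolding m_def by (rule integral_nonneg_AE) simp
  have "\<bar>mu x\<bar> \<le> (2 * (\<bar>f 0\<bar> + L) * m) * (1 + norm x)" for x
  proof -
    have "\<bar>mu x\<bar> \<le> (LINT z|(gauss_meas :: (real^'k) measure). (2 * (\<bar>f 0\<bar> + L)) * (1 + norm x) * (1 + norm z))"
      unfolding mu_def
      by (intro order_trans[OF integral_abs_bound] integral_mono integrable_abs integrable_f_mix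
          integrable_mult_right m f_mix_le)
    then show ?thesis by (simp add: m_def mult_ac)
  qed
  then show ?thesis
    using m0 L_nonneg by (intro exI[of _ "2 * (\<bar>f 0\<bar> + L) * m"]) auto
qed

lemma residual_growth: "\<exists>c \<ge> 0. \<forall>x. \<bar>f x - mu x\<bar> \<le> c * (1 + norm x)"
proof -
  obtain c where c: "c \<ge> 0" "\<And>x. \<bar>mu x\<bar> \<le> c * (1 + norm x)"
    using mu_growth by blast
  have "\<bar>f x - mu x\<bar> \<le> (\<bar>f 0\<bar> + L + c) * (1 + norm x)" for x
    using f_growth[of x] c(2)[of x] abs_triangle_ineq4[of "f x" "mu x"] by (simp add: algebra_simps)
  then show ?thesis
    using c L_nonneg by (intro exI[of _ "\<bar>f 0\<bar> + L + c"]) auto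
qed

text \<open>The hypothesis \<open>inv\<close> expresses that \<open>\<phi>\<close> depends on the
  component orthogonal to the frame only. Resampling fixes \<open>\<phi>\<close> and
  \<open>mu\<close>, and the inner average of \<open>f (mix x z)\<close> is
  \<open>mu x\<close>.\<close>

lemma integral_residual_zero:
  assumes [measurable]: "\<phi> \<in> borel_measurable borel"
    and inv: "\<And>x z. \<phi> (mix x z) = \<phi> x"
    and growth: "\<And>x. \<bar>\<phi> x\<bar> \<le> c * (1 + norm x)"
  shows "(LINT x|gauss_meas. (f x - mu x) * \<phi> x) = 0"
    and "integrable gauss_meas (\<lambda>x. (f x - mu x) * \<phi> x)"
proof -
  obtain d where d: "d \<ge> 0" "\<And>x. \<bar>f x - mu x\<bar> \<le> d * (1 + norm x)"
    using residual_growth by blast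
  have bd: "\<bar>(f x - mu x) * \<phi> x\<bar> \<le> d * c * (1 + norm x) ^ 2" for x
  proof -
    have "\<bar>f x - mu x\<bar> * \<bar>\<phi> x\<bar> \<le> (d * (1 + norm x)) * (c * (1 + norm x))"
      using d growth by (intro mult_mono) auto
    then show ?thesis by (simp add: abs_mult power2_eq_square mult_ac)
  qed
  show "integrable gauss_meas (\<lambda>x. (f x - mu x) * \<phi> x)"
    by (rule integrable_gauss_poly[OF _ bd]) simp
  have int: "integrable gauss_meas (\<lambda>p :: (real^'m) \<times> (real^'k). (f (fst p) - mu (fst p)) * \<phi> (fst p))"
    by (rule integrable_gauss_poly_pair[where c = "d * c" and m = 2 and n = 0]) (use bd in simp_all)
  have "(LINT x|gauss_meas. (f x - mu x) * \<phi> x) =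
      (LINT x|gauss_meas. LINT z|(gauss_meas :: (real^'k) measure). (f x - mu x) * \<phi> x)"
    by simp
  also have "\<dots> = (LINT x|gauss_meas. LINT z|gauss_meas. (f (mix x z) - mu x) * \<phi> x)"
    by (subst mix_swap[OF int, symmetric]) (simp add: inv)
  also have "\<dots> = (LINT x|(gauss_meas :: (real^'m) measure). 0)"
    by (intro Bochner_Integration.integral_cong refl)
      (simp add: integrable_f_mix mu_def[symmetric])
  finally show "(LINT x|gauss_meas. (f x - mu x) * \<phi> x) = 0" by simp
qed

text \<open>After resampling, \<open>coord x\<close> becomes the free Gaussian variable
  \<open>z\<close>, whereas \<open>mu\<close> and \<open>dirav w\<close> do not see
  \<open>z\<close>. Stein's identity on the fibre then trades the factor \<open>z $ j\<close> for a
  derivative along the \<open>j\<close>-th column.\<close>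

lemma integral_residual_coord:
  assumes w: "norm w \<le> 1"
  shows "(LINT x|gauss_meas. (f x - mu x) * (coord x $ j * dirav w x)) =
      (LINT x|gauss_meas. dirav w x * dirav (column j V) x)"
    and "integrable gauss_meas (\<lambda>x. (f x - mu x) * (coord x $ j * dirav w x))"
proof -
  obtain d where d: "d \<ge> 0" "\<And>x. \<bar>f x - mu x\<bar> \<le> d * (1 + norm x)"
    using residual_growth by blast
  have dw: "\<bar>dirav w x\<bar> \<le> L" for x
    using dirav_le[of w x] w mult_left_mono[of "norm w" 1 L] L_nonneg by simp
  have bd: "\<bar>(f x - mu x) * (z $ j * dirav w x)\<bar> \<le> d * L * (1 + norm x) ^ 1 * (1 + norm z) ^ 1"
    for x and z :: "real^'k"
  proof -
    have "\<bar>z $ j\<bar> \<le> 1 + norm z" using component_le_norm_cart[of z j] by simp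
    then have "\<bar>f x - mu x\<bar> * (\<bar>z $ j\<bar> * \<bar>dirav w x\<bar>) \<le> (d * (1 + norm x)) * ((1 + norm z) * L)"
      using d dw by (intro mult_mono) auto
    then show ?thesis by (simp add: abs_mult mult_ac)
  qed
  have bd': "\<bar>(f x - mu x) * (coord x $ j * dirav w x)\<bar> \<le> d * L * (1 + norm x) ^ 2" for x
  proof -
    have "d * L * (1 + norm x) ^ 1 * (1 + norm (coord x)) ^ 1 \<le> d * L * (1 + norm x) ^ 1 * (1 + norm x) ^ 1"
      using d L_nonneg norm_coord_le[of x] by (intro mult_left_mono) auto
    then show ?thesis using bd[of x "coord x"] by (simp add: power2_eq_square)
  qed
  show "integrable gauss_meas (\<lambda>x. (f x - mu x) * (coord x $ j * dirav w x))"
    by (rule integrable_gauss_poly[OF _ bd']) simp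
  have int: "integrable gauss_meas (\<lambda>p :: (real^'m) \<times> (real^'k).
      (f (fst p) - mu (fst p)) * (coord (fst p) $ j * dirav w (fst p)))"
    by (rule integrable_gauss_poly_pair[where c = "d * L" and m = 2 and n = 0]) (use bd' in simp_all)
  \<comment> \<open>On a fibre, \<open>z \<mapsto> mix x z\<close> is an affine isometry, so the
    restricted function is again Lipschitz with constant \<open>L\<close>, and its derivative along
    \<open>axis j 1\<close> is \<open>Df (mix x z) \<bullet> column j V\<close>.\<close>
  have Stein: "(LINT z|gauss_meas. (f (mix x z) - mu x) * z $ j) = dirav (column j V) x" for x
  proof -
    have "((\<lambda>z. f (mix x z) - mu x) has_derivative (\<lambda>h. Df (mix x z) \<bullet> (V *v h))) (at z)" for z
    proof -
      have "(mix x has_derivative (\<lambda>h. V *v h)) (at z)"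
        unfolding mix_def[abs_def]
        by (auto intro!: derivative_eq_intros bounded_linear_imp_has_derivative matrix_vector_mul_bounded_linear)
      from has_derivative_compose[OF this deriv] show ?thesis
        by (auto intro!: derivative_eq_intros)
    qed
    moreover have "lipschitz_on L UNIV (\<lambda>z. f (mix x z) - mu x)"
    proof (rule lipschitz_onI)
      fix z z' :: "real^'k"
      have "mix x z - mix x z' = V *v (z - z')"
        by (simp add: mix_def matrix_vector_mult_diff_distrib)
      then have "dist (mix x z) (mix x z') = dist z z'"
        by (simp add: dist_norm)
      then show "dist (f (mix x z) - mu x) (f (mix x z') - mu x) \<le> L * dist z z'"
        using lipschitz_onD[OF lip, of "mix x z" "mix x z'"] by (simp add: dist_norm)
    qed (rule L_nonneg)
    ultimately have "(LINT z|gauss_meas. (f (mix x z) - mu x) * (z \<bullet> axis j 1)) =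
        (LINT z|gauss_meas. Df (mix x z) \<bullet> (V *v axis j 1))"
      by (rule gauss_Stein(3)) (simp add: norm_axis_1)
    then show ?thesis
      by (simp add: dirav_def inner_axis matrix_vector_mul_component matrix_vector_mult_basis)
  qed
  have "(LINT x|gauss_meas. (f x - mu x) * (coord x $ j * dirav w x)) =
      (LINT x|gauss_meas. LINT z|(gauss_meas :: (real^'k) measure). (f x - mu x) * (coord x $ j * dirav w x))"
    by simp
  also have "\<dots> = (LINT x|gauss_meas. LINT z|gauss_meas. dirav w x * ((f (mix x z) - mu x) * z $ j))"
    by (subst mix_swap[OF int, symmetric]) (simp add: mult_ac)
  also have "\<dots> = (LINT x|gauss_meas. dirav w x * dirav (column j V) x)"
    by (simp add: Stein)
  finally show "(LINT x|gauss_meas. (f x - mu x) * (coord x $ j * dirav w x)) =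
      (LINT x|gauss_meas. dirav w x * dirav (column j V) x)" .
qed

text \<open>Jensen's inequality on each fibre, followed by the fact that \<open>mix x z\<close> is
  distributed like \<open>x\<close>.\<close>

lemma integral_dirav_square_le:
  "integrable gauss_meas (\<lambda>x. (dirav w x)\<^sup>2)"
  "integrable gauss_meas (\<lambda>x. (Df x \<bullet> w)\<^sup>2)"
  "(LINT x|gauss_meas. (dirav w x)\<^sup>2) \<le> (LINT x|gauss_meas. (Df x \<bullet> w)\<^sup>2)"
proof -
  have bd: "\<bar>(Df x \<bullet> w)\<^sup>2\<bar> \<le> (L * norm w)\<^sup>2" for x
    using power_mono[OF Df_inner_le[of x w], of 2] by simp
  have bd': "\<bar>(dirav w x)\<^sup>2\<bar> \<le> (L * norm w)\<^sup>2" for x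
    using power_mono[OF dirav_le[of w x], of 2] by simp
  show 1: "integrable gauss_meas (\<lambda>x. (dirav w x)\<^sup>2)"
    by (rule integrable_gauss_poly[where c = "(L * norm w)\<^sup>2" and n = 0]) (use bd' in simp_all)
  show 2: "integrable gauss_meas (\<lambda>x. (Df x \<bullet> w)\<^sup>2)"
    by (rule integrable_gauss_poly[where c = "(L * norm w)\<^sup>2" and n = 0]) (use bd in simp_all)
  have int: "integrable gauss_meas (\<lambda>p :: (real^'m) \<times> (real^'k). (Df (fst p) \<bullet> w)\<^sup>2)"
    by (rule integrable_gauss_poly[where c = "(L * norm w)\<^sup>2" and n = 0]) (use bd in simp_all)
  have int': "integrable gauss_meas (\<lambda>p. (Df (mix (fst p) (snd p)) \<bullet> w)\<^sup>2)"
    by (rule integrable_gauss_poly[where c = "(L * norm w)\<^sup>2" and n = 0]) (use bd in simp_all)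
  have int'': "integrable gauss_meas (\<lambda>z. (Df (mix x z) \<bullet> w)\<^sup>2)" for x
    by (rule integrable_gauss_poly[where c = "(L * norm w)\<^sup>2" and n = 0]) (use bd in simp_all)
  have "(LINT x|gauss_meas. (dirav w x)\<^sup>2) \<le> (LINT x|gauss_meas. LINT z|gauss_meas. (Df (mix x z) \<bullet> w)\<^sup>2)"
    unfolding dirav_def using 1 gauss_Fubini(1)[OF int']
    by (intro integral_mono gauss.integral_square_le integrable_Df_mix int'') (simp_all add: dirav_def)
  also have "\<dots> = (LINT x|gauss_meas. LINT z|(gauss_meas :: (real^'k) measure). (Df x \<bullet> w)\<^sup>2)"
    by (subst mix_swap[OF int, symmetric]) simp
  also have "\<dots> = (LINT x|gauss_meas. (Df x \<bullet> w)\<^sup>2)"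
    by simp
  finally show "(LINT x|gauss_meas. (dirav w x)\<^sup>2) \<le> (LINT x|gauss_meas. (Df x \<bullet> w)\<^sup>2)" .
qed

end

section \<open>Derivative of the residual in one entry of the frame\<close>

lemma elem_mat_mult: "elem_mat i j *v z = z $ j *\<^sub>R axis i (1 :: real)"
proof -
  have "(elem_mat i j *v z) $ a = (\<Sum>b\<in>UNIV. if b = j then (if a = i then z $ b else 0) else 0)" for a
    unfolding matrix_vector_mult_def elem_mat_def vec_lambda_beta by (intro sum.cong) auto
  then show ?thesis by (simp add: vec_eq_iff axis_def)
qed

lemma transpose_elem_mat: "transpose (elem_mat i j) = elem_mat j i"
  by (auto simp: vec_eq_iff transpose_def elem_mat_def)

context lipschitz_frame
begin

definition velocity :: "'m \<Rightarrow> 'k \<Rightarrow> real^'m \<Rightarrow> real^'k \<Rightarrow> real^'m" where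
  "velocity i j x z = (z $ j - coord x $ j) *\<^sub>R axis i 1 - x $ i *\<^sub>R column j V"

text \<open>The point of the perturbed formula, expanded in \<open>t\<close>. The quadratic term
  arises because \<open>V\<close> occurs twice in \<open>I - V V\<^sup>T\<close>; it does not
  contribute to the derivative at \<open>0\<close>, but it does enter the domination.\<close>

definition mix_path :: "'m \<Rightarrow> 'k \<Rightarrow> real \<Rightarrow> real^'m \<Rightarrow> real^'k \<Rightarrow> real^'m" where
  "mix_path i j t x z = mix x z + (t *\<^sub>R velocity i j x z - (t\<^sup>2 * x $ i) *\<^sub>R axis i 1)"

definition slope :: "'m \<Rightarrow> 'k \<Rightarrow> real^'m \<Rightarrow> real" where
  "slope i j x = (LINT z|gauss_meas. Df (mix x z) \<bullet> velocity i j x z)"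

lemma column_frame: "column j V = V *v axis j 1"
  by (simp add: matrix_vector_mult_basis)

lemma mix_path_eq:
  fixes x :: "real^'m" and z :: "real^'k" and i :: 'm and j :: 'k
  defines "Vt t \<equiv> V + t *\<^sub>R elem_mat i j"
  shows "(mat 1 - Vt t ** transpose (Vt t)) *v x + Vt t *v z = mix_path i j t x z"
proof -
  have Vt: "Vt t *v w = V *v w + (t * w $ j) *\<^sub>R axis i 1" for w
    by (simp add: Vt_def matrix_vector_mult_add_rdistrib scaleR_matrix_vector_assoc[symmetric] elem_mat_mult)
  have "transpose (Vt t) = transpose V + t *\<^sub>R elem_mat j i"
    unfolding Vt_def transpose_elem_mat[of i j, symmetric] by (simp add: transpose_def vec_eq_iff)
  then have tVt: "transpose (Vt t) *v x = coord x + (t * x $ i) *\<^sub>R axis j 1"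
    by (simp only: matrix_vector_mult_add_rdistrib scaleR_matrix_vector_assoc[symmetric]
        elem_mat_mult coord_def scaleR_scaleR)
  have "(mat 1 - Vt t ** transpose (Vt t)) *v x + Vt t *v z
      = x - Vt t *v (coord x + (t * x $ i) *\<^sub>R axis j 1) + Vt t *v z"
    by (simp only: matrix_vector_mult_diff_rdistrib matrix_vector_mul_lid matrix_vector_mul_assoc[symmetric] tVt)
  also have "\<dots> = mix_path i j t x z"
    by (simp add: Vt matrix_vector_right_distrib matrix_vector_mult_scaleR column_frame
        mix_path_def velocity_def mix_def algebra_simps power2_eq_square del: matrix_vector_mult_basis)
  finally show ?thesis .
qed

lemma norm_column_frame [simp]: "norm (column j V) = 1"
  by (simp add: column_frame norm_axis_1 del: matrix_vector_mult_basis)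

lemma velocity_measurable [measurable (raw)]:
  assumes [measurable]: "g \<in> borel_measurable M" "h \<in> borel_measurable M"
  shows "(\<lambda>x. velocity i j (g x) (h x)) \<in> borel_measurable M"
  unfolding velocity_def by measurable

lemma mix_path_measurable [measurable (raw)]:
  assumes [measurable]: "g \<in> borel_measurable M" "h \<in> borel_measurable M"
  shows "(\<lambda>x. mix_path i j t (g x) (h x)) \<in> borel_measurable M"
  unfolding mix_path_def by measurable

lemma mix_path_0 [simp]: "mix_path i j 0 x z = mix x z"
  by (simp add: mix_path_def)

lemma norm_velocity_le: "norm (velocity i j x z) \<le> 2 * norm x + norm z"
proof -
  have "norm (velocity i j x z) \<le> \<bar>z $ j - coord x $ j\<bar> + \<bar>x $ i\<bar>"
    unfolding velocity_def
    by (rule order_trans[OF norm_triangle_ineq4]) (simp add: norm_axis_1)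
  also have "\<dots> \<le> 2 * norm x + norm z"
    using component_le_norm_cart[of z j] component_le_norm_cart[of x i]
      component_le_norm_cart[of "coord x" j] norm_coord_le[of x] by simp
  finally show ?thesis .
qed

text \<open>For \<open>\<bar>t\<bar> < 1\<close> the quadratic term is at most
  \<open>\<bar>t\<bar> * norm x\<close>, which raises the \<open>2 * norm x\<close> of the velocity
  bound to \<open>3 * norm x\<close>. The product form of the bound lets \<open>z\<close> be
  integrated out first, leaving linear growth in \<open>x\<close>.\<close>

lemma f_mix_path_diff:
  assumes t: "\<bar>t\<bar> < 1"
  shows "\<bar>f (mix_path i j t x z) - f (mix x z)\<bar> \<le> 3 * L * (1 + norm x) * (1 + norm z) * \<bar>t\<bar>"
proof -
  have "\<bar>t\<^sup>2 * x $ i\<bar> \<le> \<bar>t\<bar> * norm x"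
  proof -
    have "\<bar>t\<bar> * \<bar>t\<bar> \<le> \<bar>t\<bar> * 1" using t by (intro mult_left_mono) auto
    then have "\<bar>t\<bar> * \<bar>t\<bar> * \<bar>x $ i\<bar> \<le> \<bar>t\<bar> * norm x"
      using component_le_norm_cart[of x i] by (intro mult_mono) auto
    then show ?thesis by (simp add: abs_mult power2_eq_square)
  qed
  moreover have "\<bar>t\<bar> * norm (velocity i j x z) \<le> \<bar>t\<bar> * (2 * norm x + norm z)"
    by (intro mult_left_mono norm_velocity_le) simp
  ultimately have "norm (mix_path i j t x z - mix x z) \<le> \<bar>t\<bar> * (3 * norm x + norm z)"
    using norm_triangle_ineq4[of "t *\<^sub>R velocity i j x z" "(t\<^sup>2 * x $ i) *\<^sub>R axis i 1"]
    by (simp add: mix_path_def norm_axis_1 algebra_simps)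
  also have "\<dots> \<le> \<bar>t\<bar> * (3 * ((1 + norm x) * (1 + norm z)))"
    by (intro mult_left_mono) (simp_all add: algebra_simps)
  finally have "L * norm (mix_path i j t x z - mix x z) \<le> L * (\<bar>t\<bar> * (3 * ((1 + norm x) * (1 + norm z))))"
    using L_nonneg by (intro mult_left_mono) auto
  moreover have "\<bar>f (mix_path i j t x z) - f (mix x z)\<bar> \<le> L * norm (mix_path i j t x z - mix x z)"
    using lipschitz_onD[OF lip, of "mix_path i j t x z" "mix x z"] by (simp add: dist_norm)
  ultimately show ?thesis by (simp only: mult_ac)
qed

lemma integrable_f_mix_path:
  assumes t: "\<bar>t\<bar> < 1"
  shows "integrable gauss_meas (\<lambda>z. f (mix_path i j t x z))"
proof (rule integrable_gauss_poly)
  fix z :: "real^'k"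
  have "3 * L * (1 + norm x) * (1 + norm z) * \<bar>t\<bar> \<le> 3 * L * (1 + norm x) * (1 + norm z) * 1"
    using t L_nonneg by (intro mult_left_mono) auto
  then have "\<bar>f (mix_path i j t x z) - f (mix x z)\<bar> \<le> 3 * L * (1 + norm x) * (1 + norm z)"
    using f_mix_path_diff[OF t, of i j x z] by simp
  then have "\<bar>f (mix_path i j t x z)\<bar>
      \<le> 2 * (\<bar>f 0\<bar> + L) * (1 + norm x) * (1 + norm z) + 3 * L * (1 + norm x) * (1 + norm z)"
    using f_mix_le[of x z] by linarith
  then show "\<bar>f (mix_path i j t x z)\<bar>
      \<le> ((2 * (\<bar>f 0\<bar> + L)) * (1 + norm x) + 3 * L * (1 + norm x)) * (1 + norm z) ^ 1"
    by (simp only: distrib_right power_one_right)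
qed measurable

lemma DERIV_f_mix_path:
  "((\<lambda>t. f (mix_path i j t x z)) has_real_derivative Df (mix x z) \<bullet> velocity i j x z) (at 0)"
proof -
  have "((\<lambda>t. mix_path i j t x z) has_derivative (\<lambda>t. t *\<^sub>R velocity i j x z)) (at 0)"
    unfolding mix_path_def by (auto intro!: derivative_eq_intros)
  from has_derivative_compose[OF this, of f "\<lambda>h. Df (mix x z) \<bullet> h"] deriv
  show ?thesis
    by (simp add: has_field_derivative_def mult.commute[of _ "Df (mix x z) \<bullet> velocity i j x z"])
qed

lemma cond_avg_path: "cond_avg f x (V + t *\<^sub>R elem_mat i j) = (LINT z|gauss_meas. f (mix_path i j t x z))"
  unfolding cond_avg_def mix_path_eq by (rule integral_gauss_meas[symmetric]) measurable

lemma cond_avg_0: "cond_avg f x V = mu x"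
  using cond_avg_path[of x 0] by (simp add: mu_def)

lemma integrable_one_plus_norm: "integrable gauss_meas (\<lambda>z :: 'a :: euclidean_space. 1 + norm z)"
  by (rule integrable_gauss_poly[where c = 1 and n = 1]) auto

lemma DERIV_cond_avg:
  "((\<lambda>t. cond_avg f x (V + t *\<^sub>R elem_mat i j)) has_real_derivative slope i j x) (at 0)"
  "integrable gauss_meas (\<lambda>z. Df (mix x z) \<bullet> velocity i j x z)"
proof -
  have g: "integrable gauss_meas (\<lambda>z :: real^'k. 3 * L * (1 + norm x) * (1 + norm z))"
    by (intro integrable_mult_right integrable_one_plus_norm)
  have *: "\<bar>f (mix_path i j t x z) - f (mix_path i j 0 x z)\<bar> \<le> 3 * L * (1 + norm x) * (1 + norm z) * \<bar>t\<bar>"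
    if "\<bar>t\<bar> < 1" for t z
    using f_mix_path_diff[OF that] by simp
  show "((\<lambda>t. cond_avg f x (V + t *\<^sub>R elem_mat i j)) has_real_derivative slope i j x) (at 0)"
    "integrable gauss_meas (\<lambda>z. Df (mix x z) \<bullet> velocity i j x z)"
    unfolding cond_avg_path slope_def
    using has_real_derivative_integral[OF integrable_f_mix_path g * DERIV_f_mix_path] by auto
qed

text \<open>The averaged form of the increment bound, with a constant uniform in \<open>t\<close>
  and \<open>x\<close>; it supplies the domination for the outer integral over
  \<open>x\<close>.\<close>

lemma cond_avg_diff:
  "\<exists>c \<ge> 0. \<forall>t x. \<bar>t\<bar> < 1 \<longrightarrow> \<bar>cond_avg f x (V + t *\<^sub>R elem_mat i j) - mu x\<bar> \<le> c * (1 + norm x) * \<bar>t\<bar>"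
proof -
  define m where "m = (LINT z|(gauss_meas :: (real^'k) measure). 1 + norm z)"
  have m0: "0 \<le> m" unfolding m_def by (rule integral_nonneg_AE) simp
  have "\<bar>cond_avg f x (V + t *\<^sub>R elem_mat i j) - mu x\<bar> \<le> (3 * L * m) * (1 + norm x) * \<bar>t\<bar>"
    if t: "\<bar>t\<bar> < 1" for t x
  proof -
    have "cond_avg f x (V + t *\<^sub>R elem_mat i j) - mu x
        = (LINT z|gauss_meas. f (mix_path i j t x z) - f (mix x z))"
      unfolding cond_avg_path mu_def by (simp add: integrable_f_mix_path[OF t] integrable_f_mix)
    also have "\<bar>\<dots>\<bar> \<le> (LINT z|(gauss_meas :: (real^'k) measure). 3 * L * (1 + norm x) * \<bar>t\<bar> * (1 + norm z))"
    proof (intro order_trans[OF integral_abs_bound] integral_mono integrable_abs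
          integrable_mult_right integrable_one_plus_norm Bochner_Integration.integrable_diff
          integrable_f_mix_path[OF t] integrable_f_mix)
      fix z :: "real^'k"
      show "\<bar>f (mix_path i j t x z) - f (mix x z)\<bar> \<le> 3 * L * (1 + norm x) * \<bar>t\<bar> * (1 + norm z)"
        using f_mix_path_diff[OF t, of i j x z] by (simp only: mult_ac)
    qed
    also have "\<dots> = (3 * L * m) * (1 + norm x) * \<bar>t\<bar>" by (simp add: m_def)
    finally show ?thesis .
  qed
  then show ?thesis
    using m0 L_nonneg by (intro exI[of _ "3 * L * m"]) auto
qed

lemma cond_avg_measurable [measurable]:
  "(\<lambda>x. cond_avg f x (V + t *\<^sub>R elem_mat i j)) \<in> borel_measurable borel"
  unfolding cond_avg_path by (rule gauss.borel_measurable_lebesgue_integral) (simp add: split_beta')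

text \<open>A second differentiation under the integral, now over \<open>x\<close>, of half the
  squared residual; the minus sign is that of the conditional average in
  \<open>f - mu\<close>.\<close>

lemma DERIV_resid:
  "((\<lambda>t. resid f (V + t *\<^sub>R elem_mat i j)) has_real_derivative
      - (LINT x|gauss_meas. (f x - mu x) * slope i j x)) (at 0)"
  "integrable gauss_meas (\<lambda>x. (f x - mu x) * slope i j x)"
proof -
  let ?M = "\<lambda>t x. cond_avg f x (V + t *\<^sub>R elem_mat i j)"
  obtain c where c: "c \<ge> 0" "\<And>t x. \<bar>t\<bar> < 1 \<Longrightarrow> \<bar>?M t x - mu x\<bar> \<le> c * (1 + norm x) * \<bar>t\<bar>"
    using cond_avg_diff by blast
  obtain d where d: "d \<ge> 0" "\<And>x. \<bar>f x - mu x\<bar> \<le> d * (1 + norm x)"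
    using residual_growth by blast
  have c1: "\<bar>?M t x - mu x\<bar> \<le> c * (1 + norm x)" if "\<bar>t\<bar> < 1" for t x
  proof -
    have "c * (1 + norm x) * \<bar>t\<bar> \<le> c * (1 + norm x) * 1"
      using that c(1) by (intro mult_left_mono) auto
    then show ?thesis using c(2)[OF that, of x] by simp
  qed
  have abs_half: "\<bar>1/2 * u - v\<bar> \<le> \<bar>u\<bar> + \<bar>v\<bar>" for u v :: real
    by linarith
  define H where "H t x = 1/2 * (f x - ?M t x)\<^sup>2" for t x
  have resid_eq: "resid f (V + t *\<^sub>R elem_mat i j) = (LINT x|gauss_meas. H t x)" for t
    unfolding resid_def H_def by (subst integral_gauss_meas) (simp_all add: mult.assoc)
  have H0: "H 0 x = 1/2 * (f x - mu x)\<^sup>2" for x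
    by (simp add: H_def cond_avg_0)
  have intH: "integrable gauss_meas (H t)" if t: "\<bar>t\<bar> < 1" for t
  proof (rule integrable_gauss_poly)
    fix x
    have "\<bar>f x - ?M t x\<bar> \<le> (d + c) * (1 + norm x)"
      using c1[OF t, of x] d(2)[of x] by (simp add: algebra_simps)
    from power_mono[OF this, of 2] show "\<bar>H t x\<bar> \<le> (1/2 * (d + c)\<^sup>2) * (1 + norm x) ^ 2"
      by (simp add: H_def power_mult_distrib)
  qed (simp add: H_def[abs_def])
  define g where "g x = c * (d + c) * (1 + norm x) ^ 2" for x :: "real^'m"
  have intg: "integrable gauss_meas g"
    by (rule integrable_gauss_poly[where c = "c * (d + c)" and n = 2])
      (use c d in \<open>simp_all add: g_def[abs_def]\<close>)
  have lipH: "\<bar>H t x - H 0 x\<bar> \<le> g x * \<bar>t\<bar>" if t: "\<bar>t\<bar> < 1" for t x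
  proof -
    \<comment> \<open>A difference of squares: the first factor carries
      \<open>\<bar>t\<bar>\<close>, the second grows linearly in \<open>norm x\<close>, and their
      product is the quadratic bound \<open>g\<close>.\<close>
    have "H t x - H 0 x = (?M t x - mu x) * (1/2 * (?M t x - mu x) - (f x - mu x))"
      unfolding H0 unfolding H_def by (simp add: power2_eq_square algebra_simps)
    then have "\<bar>H t x - H 0 x\<bar> = \<bar>?M t x - mu x\<bar> * \<bar>1/2 * (?M t x - mu x) - (f x - mu x)\<bar>"
      by (simp add: abs_mult)
    also have "\<dots> \<le> (c * (1 + norm x) * \<bar>t\<bar>) * ((d + c) * (1 + norm x))"
    proof (intro mult_mono c(2)[OF t])
      have "\<bar>1/2 * (?M t x - mu x) - (f x - mu x)\<bar> \<le> \<bar>?M t x - mu x\<bar> + \<bar>f x - mu x\<bar>"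
        by (rule abs_half)
      then show "\<bar>1/2 * (?M t x - mu x) - (f x - mu x)\<bar> \<le> (d + c) * (1 + norm x)"
        using c1[OF t, of x] d(2)[of x] by (simp only: distrib_right)
    qed (use c in auto)
    also have "\<dots> = g x * \<bar>t\<bar>"
      by (simp only: g_def power2_eq_square mult_ac)
    finally show ?thesis .
  qed
  have derH: "((\<lambda>t. H t x) has_real_derivative - ((f x - mu x) * slope i j x)) (at 0)" for x
    unfolding H_def by (auto intro!: derivative_eq_intros DERIV_cond_avg simp: cond_avg_0)
  note L = has_real_derivative_integral[OF intH intg lipH derH]
  show "((\<lambda>t. resid f (V + t *\<^sub>R elem_mat i j)) has_real_derivative
      - (LINT x|gauss_meas. (f x - mu x) * slope i j x)) (at 0)"
    using L(2) unfolding resid_eq by simp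
  show "integrable gauss_meas (\<lambda>x. (f x - mu x) * slope i j x)"
    using Bochner_Integration.integrable_minus[OF L(1)] by simp
qed

text \<open>In a direction \<open>w\<close> orthogonal to the frame, all the terms of the gradient that depend on \<open>x\<close>
  only through its component orthogonal to the frame integrate to zero against the residual.\<close>

lemma grad_resid_orthogonal:
  assumes w: "coord w = 0" "norm w \<le> 1"
  shows "- (\<Sum>i\<in>UNIV. w $ i * (LINT x|gauss_meas. (f x - mu x) * slope i j x)) =
      (LINT x|gauss_meas. dirav w x * dirav (column j V) x)"
proof -
  \<comment> \<open>The contribution of \<open>z $ j\<close>: here \<open>z\<close> is integrated
    out, so \<open>h\<close> is constant on fibres and orthogonal to the residual.\<close>
  define h where "h x = (LINT z|gauss_meas. Df (mix x z) \<bullet> w * z $ j)" for x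
  define m where "m = (LINT z|(gauss_meas :: (real^'k) measure). 1 + norm z)"
  have bdh: "\<bar>Df x \<bullet> w * z $ j\<bar> \<le> L * (1 + norm z)" for x and z :: "real^'k"
  proof -
    have "\<bar>Df x \<bullet> w\<bar> \<le> L"
      using Df_inner_le[of x w] mult_left_mono[OF w(2) L_nonneg] by simp
    moreover have "\<bar>z $ j\<bar> \<le> 1 + norm z"
      using component_le_norm_cart[of z j] by simp
    ultimately show ?thesis
      unfolding abs_mult using L_nonneg by (intro mult_mono) auto
  qed
  have inth: "integrable gauss_meas (\<lambda>z. Df (mix x z) \<bullet> w * z $ j)" for x
    by (rule integrable_gauss_poly[where c = L and n = 1]) (simp_all only: power_one_right bdh, measurable)
  have hm [measurable]: "h \<in> borel_measurable borel"
    unfolding h_def[abs_def]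
    by (rule gauss.borel_measurable_lebesgue_integral) (simp add: split_beta')
  have h_le: "\<bar>h x\<bar> \<le> L * m * (1 + norm x)" for x
  proof -
    have m0: "0 \<le> m" unfolding m_def by (rule integral_nonneg_AE) simp
    have "\<bar>h x\<bar> \<le> (LINT z|(gauss_meas :: (real^'k) measure). L * (1 + norm z))"
      unfolding h_def
      by (intro order_trans[OF integral_abs_bound] integral_mono integrable_abs inth
          integrable_mult_right integrable_one_plus_norm bdh)
    also have "\<dots> = L * m * 1" by (simp add: m_def)
    also have "\<dots> \<le> L * m * (1 + norm x)"
      using m0 L_nonneg by (intro mult_left_mono) auto
    finally show ?thesis .
  qed
  have h_mix: "h (mix x z) = h x" for x z
    by (simp add: h_def)
  note Z1 = integral_residual_zero[OF hm h_mix h_le]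
  have wx_le: "\<bar>(x \<bullet> w) * dirav (column j V) x\<bar> \<le> L * (1 + norm x)" for x
  proof -
    have "\<bar>x \<bullet> w\<bar> \<le> 1 + norm x"
      using Cauchy_Schwarz_ineq2[of x w] mult_left_mono[OF w(2), of "norm x"] by simp
    then have "\<bar>x \<bullet> w\<bar> * \<bar>dirav (column j V) x\<bar> \<le> (1 + norm x) * L"
      using dirav_le[of "column j V" x] by (intro mult_mono) auto
    then show ?thesis by (simp add: abs_mult mult.commute)
  qed
  have wm: "(\<lambda>x. (x \<bullet> w) * dirav (column j V) x) \<in> borel_measurable borel"
    by measurable
  have w_mix: "(mix x z \<bullet> w) * dirav (column j V) (mix x z) = (x \<bullet> w) * dirav (column j V) x" for x z
    by (simp add: inner_mix[OF w(1)])
  note Z2 = integral_residual_zero[OF wm w_mix wx_le]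
  \<comment> \<open>Weighting with \<open>w\<close> and summing over \<open>i\<close> assembles the
    unit vectors of the velocity into \<open>w\<close> and the numbers \<open>x $ i\<close> into
    \<open>x \<bullet> w\<close>, which is constant on fibres because
    \<open>coord w = 0\<close>.\<close>
  have slope: "(\<Sum>i\<in>UNIV. w $ i * slope i j x) =
      h x - coord x $ j * dirav w x - (x \<bullet> w) * dirav (column j V) x" for x
  proof -
    have "(\<Sum>i\<in>UNIV. w $ i * slope i j x)
        = (LINT z|gauss_meas. (\<Sum>i\<in>UNIV. w $ i * (Df (mix x z) \<bullet> velocity i j x z)))"
      unfolding slope_def by (simp add: DERIV_cond_avg(2))
    also have "\<dots> = (LINT z|gauss_meas. Df (mix x z) \<bullet> w * z $ j
        - coord x $ j * (Df (mix x z) \<bullet> w) - (x \<bullet> w) * (Df (mix x z) \<bullet> column j V))"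
    proof (intro Bochner_Integration.integral_cong refl)
      fix z
      have "(\<Sum>i\<in>UNIV. w $ i * (Df (mix x z) \<bullet> velocity i j x z))
        = (\<Sum>i\<in>UNIV. (z $ j - coord x $ j) * (Df (mix x z) $ i * w $ i)
            - (x $ i * w $ i) * (Df (mix x z) \<bullet> column j V))"
        by (intro sum.cong refl) (simp add: velocity_def inner_diff_right inner_axis algebra_simps)
      also have "\<dots> = (z $ j - coord x $ j) * (Df (mix x z) \<bullet> w) - (x \<bullet> w) * (Df (mix x z) \<bullet> column j V)"
        by (simp add: sum_subtractf sum_distrib_left[symmetric] sum_distrib_right[symmetric]
            inner_vec_def[of _ w])
      finally show "(\<Sum>i\<in>UNIV. w $ i * (Df (mix x z) \<bullet> velocity i j x z)) = Df (mix x z) \<bullet> w * z $ j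
        - coord x $ j * (Df (mix x z) \<bullet> w) - (x \<bullet> w) * (Df (mix x z) \<bullet> column j V)"
        by (simp add: algebra_simps)
    qed
    also have "\<dots> = h x - coord x $ j * dirav w x - (x \<bullet> w) * dirav (column j V) x"
      unfolding h_def dirav_def by (simp add: inth integrable_Df_mix)
    finally show ?thesis .
  qed
  have "(\<Sum>i\<in>UNIV. w $ i * (LINT x|gauss_meas. (f x - mu x) * slope i j x))
      = (LINT x|gauss_meas. (\<Sum>i\<in>UNIV. w $ i * ((f x - mu x) * slope i j x)))"
    by (simp add: DERIV_resid(2))
  also have "\<dots> = (LINT x|gauss_meas. (f x - mu x) * h x - (f x - mu x) * (coord x $ j * dirav w x)
      - (f x - mu x) * ((x \<bullet> w) * dirav (column j V) x))"
  proof (intro Bochner_Integration.integral_cong refl)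
    fix x
    have "(\<Sum>i\<in>UNIV. w $ i * ((f x - mu x) * slope i j x)) = (f x - mu x) * (\<Sum>i\<in>UNIV. w $ i * slope i j x)"
      by (simp add: sum_distrib_left mult_ac)
    then show "(\<Sum>i\<in>UNIV. w $ i * ((f x - mu x) * slope i j x)) = (f x - mu x) * h x
      - (f x - mu x) * (coord x $ j * dirav w x) - (f x - mu x) * ((x \<bullet> w) * dirav (column j V) x)"
      by (simp only: slope right_diff_distrib)
  qed
  \<comment> \<open>The first and the last term vanish by orthogonality; the middle one, with the
    factor \<open>coord x $ j\<close> that varies along fibres, is evaluated by Stein's
    identity.\<close>
  also have "\<dots> = - (LINT x|gauss_meas. dirav w x * dirav (column j V) x)"
    using Z1 Z2 integral_residual_coord[OF w(2), of j] by simp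
  finally show ?thesis by simp
qed

section \<open>Rows of the projection and the Frobenius bound\<close>

lemma norm_complement_le: "norm (x - V *v coord x) \<le> norm x"
proof (rule power2_le_imp_le)
  have "(norm (x - V *v coord x))\<^sup>2 = (norm x)\<^sup>2 - (norm (coord x))\<^sup>2"
    by (simp add: power2_norm_eq_inner inner_diff_left inner_diff_right inner_frame
        inner_commute[of "V *v coord x" x] linear_diff[OF linear_coord])
  then show "(norm (x - V *v coord x))\<^sup>2 \<le> (norm x)\<^sup>2" by simp
qed simp

text \<open>The projection is symmetric, so its \<open>a\<close>-th row is the image of the
  \<open>a\<close>-th unit vector; in this form it is visibly orthogonal to the frame and of norm at
  most 1.\<close>

definition row_proj :: "'m \<Rightarrow> real^'m" where
  "row_proj a = axis a 1 - V *v coord (axis a 1)"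

lemma row_proj_nth: "row_proj a $ i = (mat 1 - V ** transpose V) $ a $ i"
proof -
  have "(V *v coord (axis a 1)) $ i = (V ** transpose V) $ i $ a"
    by (simp add: coord_def matrix_vector_mult_basis column_def matrix_vector_mult_def[of V]
        matrix_matrix_mult_def del: transpose_matrix_vector)
  also have "\<dots> = (V ** transpose V) $ a $ i"
    by (simp add: matrix_matrix_mult_def transpose_def mult.commute)
  finally show ?thesis
    by (simp add: row_proj_def mat_def axis_def)
qed

lemma coord_row_proj: "coord (row_proj a) = 0"
  by (simp add: row_proj_def linear_diff[OF linear_coord])

lemma norm_row_proj: "norm (row_proj a) \<le> 1"
  using norm_complement_le[of "axis a 1"] by (simp add: row_proj_def norm_axis_1)

text \<open>By symmetry of the projection the summands are the squared components of the projection
  of \<open>v\<close>, which does not increase the norm.\<close>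

lemma sum_row_proj_le: "(\<Sum>a\<in>UNIV. (v \<bullet> row_proj a)\<^sup>2) \<le> (norm v)\<^sup>2"
proof -
  have "v \<bullet> row_proj a = (v - V *v coord v) $ a" for a
  proof -
    have "v \<bullet> (V *v coord (axis a 1)) = axis a 1 \<bullet> (V *v coord v)"
      by (simp only: inner_frame inner_commute)
    then show ?thesis by (simp add: row_proj_def inner_diff_right inner_axis inner_axis')
  qed
  then have "(\<Sum>a\<in>UNIV. (v \<bullet> row_proj a)\<^sup>2) = (norm (v - V *v coord v))\<^sup>2"
    unfolding power2_norm_eq_inner by (simp add: inner_vec_def power2_eq_square)
  also have "\<dots> \<le> (norm v)\<^sup>2"
    by (intro power_mono norm_complement_le) simp
  finally show ?thesis .
qed

text \<open>The link to the spectrum: on a unit eigenvector the quadratic form of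
  \<open>grad_cov Df\<close> is the eigenvalue.\<close>

lemma integral_Df_square: "(LINT x|gauss_meas. (Df x \<bullet> v)\<^sup>2) = v \<bullet> (grad_cov Df *v v)"
proof -
  have int: "integrable gauss_meas (\<lambda>x. Df x $ i * Df x $ k)" for i k
  proof (rule integrable_gauss_poly[where c = "L * L" and n = 0])
    fix x
    have "\<bar>Df x $ i\<bar> \<le> L" for i
      using component_le_norm_cart[of "Df x" i] norm_Df_le[of x] by simp
    then show "\<bar>Df x $ i * Df x $ k\<bar> \<le> L * L * (1 + norm x) ^ 0"
      unfolding abs_mult using L_nonneg by (simp add: mult_mono)
  qed measurable
  have "(LINT x|gauss_meas. (Df x \<bullet> v)\<^sup>2)
      = (LINT x|gauss_meas. (\<Sum>i\<in>UNIV. \<Sum>k\<in>UNIV. v $ i * v $ k * (Df x $ i * Df x $ k)))"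
    by (simp add: inner_vec_def power2_eq_square sum_product mult_ac)
  also have "\<dots> = (\<Sum>i\<in>UNIV. \<Sum>k\<in>UNIV. v $ i * v $ k * grad_cov Df $ i $ k)"
    by (simp add: int grad_cov_def integral_gauss_meas)
  also have "\<dots> = v \<bullet> (grad_cov Df *v v)"
    by (simp add: inner_vec_def matrix_vector_mult_def sum_distrib_left mult_ac)
  finally show ?thesis .
qed

definition grad_resid :: "real^'k^'m" where
  "grad_resid = (\<chi> i j. - (LINT x|gauss_meas. (f x - mu x) * slope i j x))"

text \<open>Entrywise Cauchy-Schwarz bounds each squared entry by a row factor times a column
  factor, so the double sum factorizes. The row factors add up to at most \<open>L\<^sup>2\<close>,
  since the rows of a projection are summed before the pointwise bound on \<open>Df\<close> is used;
  summing row by row avoids a factor \<open>m\<close>.\<close>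

lemma frob_norm_grad_resid_le:
  "frob_norm ((mat 1 - V ** transpose V) ** grad_resid)
     \<le> L * sqrt (\<Sum>j\<in>UNIV. LINT x|gauss_meas. (Df x \<bullet> column j V)\<^sup>2)"
proof -
  let ?G = "(mat 1 - V ** transpose V) ** grad_resid"
  define I where "I w = (LINT x|gauss_meas. (Df x \<bullet> w)\<^sup>2)" for w
  have I0: "0 \<le> I w" for w unfolding I_def by (rule integral_nonneg_AE) simp
  have entry: "(?G $ a $ j)\<^sup>2 \<le> I (row_proj a) * I (column j V)" for a j
  proof -
    let ?u = "dirav (row_proj a)" and ?v = "dirav (column j V)"
    have "?G $ a $ j = - (\<Sum>i\<in>UNIV. row_proj a $ i * (LINT x|gauss_meas. (f x - mu x) * slope i j x))"
      by (simp add: matrix_matrix_mult_def row_proj_nth grad_resid_def sum_negf)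
    also have "\<dots> = (LINT x|gauss_meas. ?u x * ?v x)"
      by (rule grad_resid_orthogonal[OF coord_row_proj norm_row_proj])
    finally have G: "?G $ a $ j = (LINT x|gauss_meas. ?u x * ?v x)" .
    have "integrable gauss_meas (\<lambda>x. ?u x * ?v x)"
    proof (rule integrable_gauss_poly)
      fix x
      show "\<bar>?u x * ?v x\<bar> \<le> (L * norm (row_proj a)) * (L * norm (column j V)) * (1 + norm x) ^ 0"
        unfolding abs_mult power_0 mult_1_right
        using L_nonneg by (intro mult_mono dirav_le) auto
    qed measurable
    then have "(?G $ a $ j)\<^sup>2 \<le> (LINT x|gauss_meas. (?u x)\<^sup>2) * (LINT x|gauss_meas. (?v x)\<^sup>2)"
      unfolding G by (intro integral_mult_square_le integral_dirav_square_le)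
    also have "\<dots> \<le> I (row_proj a) * I (column j V)"
      unfolding I_def by (intro mult_mono integral_dirav_square_le integral_nonneg_AE) auto
    finally show ?thesis .
  qed
  have "(\<Sum>a\<in>UNIV. I (row_proj a)) = (LINT x|gauss_meas. (\<Sum>a\<in>UNIV. (Df x \<bullet> row_proj a)\<^sup>2))"
    unfolding I_def by (simp add: integral_dirav_square_le)
  also have "\<dots> \<le> (LINT x|(gauss_meas :: (real^'m) measure). L\<^sup>2)"
  proof (intro integral_mono Bochner_Integration.integrable_sum integral_dirav_square_le)
    fix x
    show "(\<Sum>a\<in>UNIV. (Df x \<bullet> row_proj a)\<^sup>2) \<le> L\<^sup>2"
      using sum_row_proj_le[of "Df x"] power_mono[OF norm_Df_le[of x], of 2] by simp
  qed simp
  finally have rows: "(\<Sum>a\<in>UNIV. I (row_proj a)) \<le> L\<^sup>2" by simp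
  have "(\<Sum>a\<in>UNIV. \<Sum>j\<in>UNIV. (?G $ a $ j)\<^sup>2) \<le> (\<Sum>a\<in>UNIV. \<Sum>j\<in>UNIV. I (row_proj a) * I (column j V))"
    by (intro sum_mono entry)
  also have "\<dots> = (\<Sum>a\<in>UNIV. I (row_proj a)) * (\<Sum>j\<in>UNIV. I (column j V))"
    by (simp add: sum_product)
  also have "\<dots> \<le> L\<^sup>2 * (\<Sum>j\<in>UNIV. I (column j V))"
    by (intro mult_right_mono rows sum_nonneg I0)
  finally have "sqrt (\<Sum>a\<in>UNIV. \<Sum>j\<in>UNIV. (?G $ a $ j)\<^sup>2) \<le> sqrt (L\<^sup>2 * (\<Sum>j\<in>UNIV. I (column j V)))"
    by (rule real_sqrt_le_mono)
  then show ?thesis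
    using L_nonneg by (simp add: frob_norm_def real_sqrt_mult I_def)
qed

end

section \<open>Evaluation at the eigenvectors\<close>

theorem theorem3:
  fixes f :: "real^'m \<Rightarrow> real"
    and Df :: "real^'m \<Rightarrow> real^'m"
    and L :: real
    and W1 :: "real^'n^'m" and W2 :: "real^'k^'m"
    and l1 :: "'n \<Rightarrow> real" and l2 :: "'k \<Rightarrow> real"
  assumes cont: "continuous_on UNIV f"
    and deriv: "\<And>x. (f has_derivative (\<lambda>h. Df x \<bullet> h)) (at x)"
    and deriv_cont: "continuous_on UNIV Df"
    and sq_int_f: "integrable lborel (\<lambda>x. (f x)\<^sup>2 * gauss_dens x)"
    and sq_int_Df: "\<And>i. integrable lborel (\<lambda>x. (Df x $ i)\<^sup>2 * gauss_dens x)"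
    and lip: "lipschitz_on L UNIV f"
    and dims: "CARD('n) + CARD('k) = CARD('m)"
    and orth1: "transpose W1 ** W1 = mat 1"
    and orth2: "transpose W2 ** W2 = mat 1"
    and orth12: "transpose W1 ** W2 = 0"
    and eig1: "\<And>j. grad_cov Df *v column j W1 = l1 j *\<^sub>R column j W1"
    and eig2: "\<And>j. grad_cov Df *v column j W2 = l2 j *\<^sub>R column j W2"
    and gap: "\<And>i j. l1 i > l2 j"
  shows "\<exists>G :: real^'k^'m.
           (\<forall>i j. ((\<lambda>t. resid f (W2 + t *\<^sub>R elem_mat i j)) has_real_derivative G $ i $ j) (at 0))
         \<and> frob_norm ((mat 1 - W2 ** transpose W2) ** G)
             \<le> L * (2 * sqrt (real CARD('m)) + sqrt (real CARD('k))) * sqrt (\<Sum>j\<in>UNIV. l2 j)"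
proof -
  interpret lipschitz_frame f Df L W2
    by unfold_locales (fact deriv deriv_cont lip orth2)+
  \<comment> \<open>The columns of \<open>W2\<close> are unit eigenvectors. Writing each eigenvalue
    as the integral of a square also gives its nonnegativity, which is needed to enlarge the
    constant.\<close>
  have l2: "(LINT x|gauss_meas. (Df x \<bullet> column j W2)\<^sup>2) = l2 j" for j
    unfolding integral_Df_square eig2 by (simp add: power2_norm_eq_inner[symmetric])
  have "0 \<le> l2 j" for j
    unfolding l2[symmetric] by (rule integral_nonneg_AE) simp
  then have s: "0 \<le> sqrt (\<Sum>j\<in>UNIV. l2 j)"
    by (simp add: sum_nonneg)
  have "1 \<le> sqrt (real CARD('m))"
    by (simp add: Suc_leI)
  moreover have "0 \<le> sqrt (real CARD('k))"
    by simp
  ultimately have "1 \<le> 2 * sqrt (real CARD('m)) + sqrt (real CARD('k))"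
    by linarith
  then have "L * 1 * sqrt (\<Sum>j\<in>UNIV. l2 j)
      \<le> L * (2 * sqrt (real CARD('m)) + sqrt (real CARD('k))) * sqrt (\<Sum>j\<in>UNIV. l2 j)"
    using L_nonneg s by (intro mult_right_mono mult_left_mono)
  then have "frob_norm ((mat 1 - W2 ** transpose W2) ** grad_resid)
      \<le> L * (2 * sqrt (real CARD('m)) + sqrt (real CARD('k))) * sqrt (\<Sum>j\<in>UNIV. l2 j)"
    using frob_norm_grad_resid_le by (simp add: l2)
  moreover have "((\<lambda>t. resid f (W2 + t *\<^sub>R elem_mat i j)) has_real_derivative grad_resid $ i $ j) (at 0)" for i j
    using DERIV_resid(1) by (simp add: grad_resid_def)
  ultimately show ?thesis by blast
qed

end
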